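(* The triangulation functor $\Delta$ of the spined category $\mathrm{Grph}_m$ coincides with treewidth: for every finite simple graph $G$, $\Delta[G]$ equals the treewidth of $G$, where the treewidth of $G$ is the minimum, over all chordal completions $G'$ of $G$, of the number of vertices of a largest complete subgraph of $G'$.
   Context: $\mathbb{N}$ denotes the natural numbers including $0$; $\mathcal{C}(X,Y)$ denotes the collection of morphisms $X\to Y$ in $\mathcal{C}$. **Spined category.** A spined category $(\mathcal{C},\Omega,\mathfrak{P})$ consists of a category $\mathcal{C}$ equipped with - a sequence $\Omega:\mathbb{N}\to\mathrm{ob}\,\mathcal{C}$, called the spine (write $\Omega_n$ for its $n$-th term); - an operation $\mathfrak{P}$, called the proxy pushout, that assigns to each diagram (span) $G\xleftarrow{g}\Omega_n\xrightarrow{h}H$ in $\mathcal{C}$ a distinguished cocone $G\xrightarrow{\mathfrak{P}(g,h)_g}\mathfrak{P}(g,h)\xleftarrow{\mathfrak{P}(g,h)_h}H$ (so $\mathfrak{P}(g,h)_g\circ g=\mathfrak{P}(g,h)_h\circ h$); subject to two conditions: - (SC1) for every $X\in\mathrm{ob}\,\mathcal{C}$ there is $n\in\mathbb{N}$ such that $\mathcal{C}(X,\Omega_n)\neq\emptyset$; - (SC2) given any diagram $G'\xleftarrow{g'}G\xleftarrow{g}\Omega_n\xrightarrow{h}H\xrightarrow{h'}H'$ there is a unique morphism $(g',h'):\mathfrak{P}(g,h)\to\mathfrak{P}(g'\circ g,h'\circ h)$ such that $(g',h')\circ\mathfrak{P}(g,h)_g=\mathfrak{P}(g'\circ g,h'\circ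 h)_{g'\circ g}\circ g'$ and $(g',h')\circ\mathfrak{P}(g,h)_h=\mathfrak{P}(g'\circ g,h'\circ h)_{h'\circ h}\circ h'$. **Spinal functor.** Given spined categories $(\mathcal{C},\Omega^{\mathcal{C}},\mathfrak{P}^{\mathcal{C}})$ and $(\mathcal{D},\Omega^{\mathcal{D}},\mathfrak{P}^{\mathcal{D}})$, a functor $F:\mathcal{C}\to\mathcal{D}$ is a spinal functor if - (SF1) it preserves the spine: $F[\Omega^{\mathcal{C}}_n]=\Omega^{\mathcal{D}}_n$ for all $n$; - (SF2) it preserves proxy pushouts: for every span $G\xleftarrow{g}\Omega^{\mathcal{C}}_n\xrightarrow{h}H$ in $\mathcal{C}$, one has $F[\mathfrak{P}^{\mathcal{C}}(g,h)]=\mathfrak{P}^{\mathcal{D}}(Fg,Fh)$, $F\mathfrak{P}^{\mathcal{C}}(g,h)_g=\mathfrak{P}^{\mathcal{D}}(Fg,Fh)_{Fg}$ and $F\mathfrak{P}^{\mathcal{C}}(g,h)_h=\mathfrak{P}^{\mathcal{D}}(Fg,Fh)_{Fh}$. **Nat.** $\mathrm{Nat}$ is the spined category given by the poset $(\mathbb{N},\leq)$ regarded as a category, with spine $\Omega_n=n$ and with suprema (maxima) as proxy pushouts, i.e. the proxy pushout of $a\leftarrow n\to b$ is $\max(a,b)$. **S-functor, measurable, pseudo-chordal.** An S-functor on a spined category $\mathcal{C}$ is a spinal functor $\mathcal{C}\to\mathrm{Nat}$. A spined category is measurable if there is at least one S-functor on it. An object $X$ of $\mathcal{C}$ is pseudo-chordal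 if $F[X]=G[X]$ for any two S-functors $F,G:\mathcal{C}\to\mathrm{Nat}$; $\mathrm{pc}\,\mathcal{C}$ denotes the class of pseudo-chordal objects. **Triangulation functor.** For a measurable spined category $\mathcal{C}$ and any S-functor $s$ on it, the triangulation functor of $\mathcal{C}$ is the map $\Delta:\mathcal{C}\to\mathrm{Nat}$ given on objects by $\Delta[G]=\min\{\,s(H)\mid H\in\mathrm{pc}\,\mathcal{C},\ \mathcal{C}(G,H)\neq\emptyset\,\}$. (It does not depend on the choice of $s$, since all S-functors agree on pseudo-chordal objects.) **The spined category $\mathrm{Grph}_m$.** Graphs are finite simple graphs (undirected, no loops or multiple edges). $\mathrm{Grph}$ is the category of graphs and graph homomorphisms; $\mathrm{Grph}_m$ has the same objects, with the monomorphisms of $\mathrm{Grph}$ (i.e. the homomorphisms injective on vertices) as arrows. Its spine is $\Omega_n=K_n$, the complete graph on $n$ vertices (every pair of distinct vertices is joined by an edge). Its proxy pushouts are inherited from $\mathrm{Grph}$: each span of monomorphisms $G\xleftarrow{g}\Omega_n\xrightarrow{h}H$ is assigned its (chosen) pushout square in $\mathrm{Grph}$, i.e. the graph obtained by gluing $G$ and $H$ along the images of $K_n$. This spined category is measurable: the map $\omega$ sending each graph to the number of vertices of its largest complete subgraph is an S-functor. **Chordal graphs and completions.** A graph is chordal if every cycle on more than $3$ vertices has a chord, i.e. an edge joining two vertices of the cycle that are not adjacent along the cycle. A chordal completion of $G$ is a chordal graph on the same vertex set as $G$ whose edge set contains that of $G$. *)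

theory Defs
  imports "HOL-Library.FuncSet" "HOL-Library.Infinite_Typeclass"
begin

section \<open>Categories\<close>

record ('o, 'm) cat =
  obj :: "'o set"
  arr :: "'m set"
  src :: "'m \<Rightarrow> 'o"
  tgt :: "'m \<Rightarrow> 'o"
  ident :: "'o \<Rightarrow> 'm"
  cmp :: "'m \<Rightarrow> 'm \<Rightarrow> 'm"  \<comment> \<open>\<open>cmp C g f\<close> is \<open>g\<close> after \<open>f\<close>\<close>

definition hom :: "('o, 'm, 'x) cat_scheme \<Rightarrow> 'o \<Rightarrow> 'o \<Rightarrow> 'm set" where
  "hom C X Y = {f \<in> arr C. src C f = X \<and> tgt C f = Y}"

locale category =
  fixes C :: "('o, 'm, 'x) cat_scheme" (structure)
  assumes src_obj: "f \<in> arr C \<Longrightarrow> src C f \<in> obj C"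
    and tgt_obj: "f \<in> arr C \<Longrightarrow> tgt C f \<in> obj C"
    and ident_hom: "X \<in> obj C \<Longrightarrow> ident C X \<in> hom C X X"
    and cmp_hom: "\<lbrakk>f \<in> hom C X Y; g \<in> hom C Y Z\<rbrakk> \<Longrightarrow> cmp C g f \<in> hom C X Z"
    and cmp_ident_right: "f \<in> hom C X Y \<Longrightarrow> cmp C f (ident C X) = f"
    and cmp_ident_left: "f \<in> hom C X Y \<Longrightarrow> cmp C (ident C Y) f = f"
    and cmp_assoc: "\<lbrakk>f \<in> hom C W X; g \<in> hom C X Y; h \<in> hom C Y Z\<rbrakk>
      \<Longrightarrow> cmp C h (cmp C g f) = cmp C (cmp C h g) f"

definition monomorphism :: "('o, 'm, 'x) cat_scheme \<Rightarrow> 'm \<Rightarrow> bool" where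
  "monomorphism C f \<longleftrightarrow> f \<in> arr C \<and>
    (\<forall>W. \<forall>a \<in> hom C W (src C f). \<forall>b \<in> hom C W (src C f). cmp C f a = cmp C f b \<longrightarrow> a = b)"

record ('o, 'm) cocone =
  apex :: 'o
  left_leg :: 'm
  right_leg :: 'm

definition is_pushout :: "('o, 'm, 'x) cat_scheme \<Rightarrow> 'm \<Rightarrow> 'm \<Rightarrow> ('o, 'm) cocone \<Rightarrow> bool" where
  "is_pushout C g h c \<longleftrightarrow>
     left_leg c \<in> hom C (tgt C g) (apex c) \<and>
     right_leg c \<in> hom C (tgt C h) (apex c) \<and>
     cmp C (left_leg c) g = cmp C (right_leg c) h \<and>
     (\<forall>Q. \<forall>a \<in> hom C (tgt C g) Q. \<forall>b \<in> hom C (tgt C h) Q. cmp C a g = cmp C b h \<longrightarrow>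
       (\<exists>!u. u \<in> hom C (apex c) Q \<and> cmp C u (left_leg c) = a \<and> cmp C u (right_leg c) = b))"


section \<open>Spined categories\<close>

record ('o, 'm) spined_cat = "('o, 'm) cat" +
  spine :: "nat \<Rightarrow> 'o"
  proxy :: "'m \<Rightarrow> 'm \<Rightarrow> ('o, 'm) cocone"

locale spined_category = category C
  for C :: "('o, 'm, 'x) spined_cat_scheme" (structure) +
  assumes spine_obj: "spine C n \<in> obj C"
    and proxy_cocone: "\<lbrakk>g \<in> hom C (spine C n) G; h \<in> hom C (spine C n) H\<rbrakk> \<Longrightarrow>
        left_leg (proxy C g h) \<in> hom C G (apex (proxy C g h)) \<and>
        right_leg (proxy C g h) \<in> hom C H (apex (proxy C g h)) \<and>
        cmp C (left_leg (proxy C g h)) g = cmp C (right_leg (proxy C g h)) h"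
    and SC1: "X \<in> obj C \<Longrightarrow> \<exists>n. hom C X (spine C n) \<noteq> {}"
    and SC2: "\<lbrakk>g \<in> hom C (spine C n) G; h \<in> hom C (spine C n) H;
               g' \<in> hom C G G'; h' \<in> hom C H H'\<rbrakk> \<Longrightarrow>
        \<exists>!u. u \<in> hom C (apex (proxy C g h)) (apex (proxy C (cmp C g' g) (cmp C h' h))) \<and>
          cmp C u (left_leg (proxy C g h)) =
            cmp C (left_leg (proxy C (cmp C g' g) (cmp C h' h))) g' \<and>
          cmp C u (right_leg (proxy C g h)) =
            cmp C (right_leg (proxy C (cmp C g' g) (cmp C h' h))) h'"

record ('o, 'm, 'p, 'q) functor_data =
  fobj :: "'o \<Rightarrow> 'p"
  farr :: "'m \<Rightarrow> 'q"

locale is_functor = C: category C + D: category D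
  for C :: "('o, 'm, 'x) cat_scheme" and D :: "('p, 'q, 'y) cat_scheme" +
  fixes F :: "('o, 'm, 'p, 'q) functor_data"
  assumes fobj_obj: "X \<in> obj C \<Longrightarrow> fobj F X \<in> obj D"
    and farr_hom: "f \<in> hom C X Y \<Longrightarrow> farr F f \<in> hom D (fobj F X) (fobj F Y)"
    and farr_ident: "X \<in> obj C \<Longrightarrow> farr F (ident C X) = ident D (fobj F X)"
    and farr_cmp: "\<lbrakk>f \<in> hom C X Y; g \<in> hom C Y Z\<rbrakk>
      \<Longrightarrow> farr F (cmp C g f) = cmp D (farr F g) (farr F f)"

locale spinal_functor = C: spined_category C + D: spined_category D + is_functor C D F
  for C :: "('o, 'm, 'x) spined_cat_scheme" and D :: "('p, 'q, 'y) spined_cat_scheme"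
    and F :: "('o, 'm, 'p, 'q) functor_data" +
  assumes SF1: "fobj F (spine C n) = spine D n"
    and SF2: "\<lbrakk>g \<in> hom C (spine C n) G; h \<in> hom C (spine C n) H\<rbrakk> \<Longrightarrow>
        fobj F (apex (proxy C g h)) = apex (proxy D (farr F g) (farr F h)) \<and>
        farr F (left_leg (proxy C g h)) = left_leg (proxy D (farr F g) (farr F h)) \<and>
        farr F (right_leg (proxy C g h)) = right_leg (proxy D (farr F g) (farr F h))"

text \<open>The poset of natural numbers; the unique arrow from \<open>a\<close> to \<open>b\<close> is the pair \<open>(a, b)\<close>.\<close>

definition Nat_cat :: "(nat, nat \<times> nat) spined_cat" where
  "Nat_cat = \<lparr>obj = UNIV, arr = {(a, b). a \<le> b}, src = fst, tgt = snd,
     ident = (\<lambda>a. (a, a)), cmp = (\<lambda>g f. (fst f, snd g)),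
     spine = (\<lambda>n. n),
     proxy = (\<lambda>g h. \<lparr>apex = max (snd g) (snd h),
       left_leg = (snd g, max (snd g) (snd h)), right_leg = (snd h, max (snd g) (snd h))\<rparr>)\<rparr>"

abbreviation S_functor ::
  "('o, 'm, 'x) spined_cat_scheme \<Rightarrow> ('o, 'm, nat, nat \<times> nat) functor_data \<Rightarrow> bool" where
  "S_functor C s \<equiv> spinal_functor C Nat_cat s"

definition measurable :: "('o, 'm, 'x) spined_cat_scheme \<Rightarrow> bool" where
  "measurable C \<longleftrightarrow> spined_category C \<and> (\<exists>s. S_functor C s)"

definition pseudo_chordal :: "('o, 'm, 'x) spined_cat_scheme \<Rightarrow> 'o set" where
  "pseudo_chordal C =
     {X \<in> obj C. \<forall>F G. S_functor C F \<longrightarrow> S_functor C G \<longrightarrow> fobj F X = fobj G X}"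

text \<open>The minimum is over a possibly infinite set of naturals, hence \<open>LEAST\<close> and not \<open>Min\<close>.
  The set is nonempty by \<open>SC1\<close>, since spine objects are pseudo-chordal.\<close>

definition triangulation ::
  "('o, 'm, 'x) spined_cat_scheme \<Rightarrow> ('o, 'm, nat, nat \<times> nat) functor_data \<Rightarrow> 'o \<Rightarrow> nat" where
  "triangulation C s G =
     (LEAST k. \<exists>H \<in> pseudo_chordal C. hom C G H \<noteq> {} \<and> k = fobj s H)"


section \<open>Finite simple graphs\<close>

record 'v graph =
  verts :: "'v set"
  edges :: "'v set set"

definition simple_graph :: "'v graph \<Rightarrow> bool" where
  "simple_graph G \<longleftrightarrow> finite (verts G) \<and>
     (\<forall>e \<in> edges G. \<exists>u \<in> verts G. \<exists>v \<in> verts G. u \<noteq> v \<and> e = {u, v})"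

definition complete_subgraph :: "'v graph \<Rightarrow> 'v set \<Rightarrow> bool" where
  "complete_subgraph G S \<longleftrightarrow>
     S \<subseteq> verts G \<and> (\<forall>u \<in> S. \<forall>v \<in> S. u \<noteq> v \<longrightarrow> {u, v} \<in> edges G)"

definition is_complete_graph :: "nat \<Rightarrow> 'v graph \<Rightarrow> bool" where
  "is_complete_graph n G \<longleftrightarrow>
     simple_graph G \<and> card (verts G) = n \<and> complete_subgraph G (verts G)"

definition clique_number :: "'v graph \<Rightarrow> nat" where
  "clique_number G = Max {card S | S. complete_subgraph G S}"

text \<open>A cycle is given by the list of its vertices in cyclic order.\<close>

definition is_cycle :: "'v graph \<Rightarrow> 'v list \<Rightarrow> bool" where
  "is_cycle G xs \<longleftrightarrow> 3 \<le> length xs \<and> distinct xs \<and> set xs \<subseteq> verts G \<and>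
     (\<forall>i < length xs. {xs ! i, xs ! (Suc i mod length xs)} \<in> edges G)"

definition has_chord :: "'v graph \<Rightarrow> 'v list \<Rightarrow> bool" where
  "has_chord G xs \<longleftrightarrow> (\<exists>i < length xs. \<exists>j < length xs.
     i \<noteq> j \<and> j \<noteq> Suc i mod length xs \<and> i \<noteq> Suc j mod length xs \<and> {xs ! i, xs ! j} \<in> edges G)"

definition chordal :: "'v graph \<Rightarrow> bool" where
  "chordal G \<longleftrightarrow> (\<forall>xs. is_cycle G xs \<longrightarrow> 3 < length xs \<longrightarrow> has_chord G xs)"

definition chordal_completion :: "'v graph \<Rightarrow> 'v graph \<Rightarrow> bool" where
  "chordal_completion G G' \<longleftrightarrow>
     simple_graph G' \<and> chordal G' \<and> verts G' = verts G \<and> edges G \<subseteq> edges G'"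

text \<open>No \<open>-1\<close>: in this normalisation the complete graph on \<open>n\<close> vertices has treewidth \<open>n\<close>.\<close>

definition treewidth :: "'v graph \<Rightarrow> nat" where
  "treewidth G = (LEAST k. \<exists>G'. chordal_completion G G' \<and> k = clique_number G')"


section \<open>The categories of graphs\<close>

text \<open>Vertex maps are \<open>undefined\<close> off the vertex set of the domain, so that equality of arrows
  is equality of maps on vertices.\<close>

record 'v graph_arrow =
  dom_graph :: "'v graph"
  vmap :: "'v \<Rightarrow> 'v"
  cod_graph :: "'v graph"

definition graph_hom :: "'v graph_arrow \<Rightarrow> bool" where
  "graph_hom f \<longleftrightarrow> simple_graph (dom_graph f) \<and> simple_graph (cod_graph f) \<and>
     vmap f \<in> verts (dom_graph f) \<rightarrow>\<^sub>E verts (cod_graph f) \<and>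
     (\<forall>u v. {u, v} \<in> edges (dom_graph f) \<longrightarrow> {vmap f u, vmap f v} \<in> edges (cod_graph f))"

definition Grph :: "('v graph, 'v graph_arrow) cat" where
  "Grph = \<lparr>obj = {G. simple_graph G}, arr = {f. graph_hom f},
     src = dom_graph, tgt = cod_graph,
     ident = (\<lambda>G. \<lparr>dom_graph = G, vmap = (\<lambda>v \<in> verts G. v), cod_graph = G\<rparr>),
     cmp = (\<lambda>g f. \<lparr>dom_graph = dom_graph f,
        vmap = compose (verts (dom_graph f)) (vmap g) (vmap f), cod_graph = cod_graph g\<rparr>)\<rparr>"

text \<open>The parameter \<open>K\<close> is a choice of complete graphs and \<open>P\<close> a choice of pushouts.\<close>

definition Grph_m :: "(nat \<Rightarrow> 'v graph)
    \<Rightarrow> ('v graph_arrow \<Rightarrow> 'v graph_arrow \<Rightarrow> ('v graph, 'v graph_arrow) cocone)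
    \<Rightarrow> ('v graph, 'v graph_arrow) spined_cat" where
  "Grph_m K P = \<lparr>obj = obj Grph, arr = {f. monomorphism Grph f},
     src = src Grph, tgt = tgt Grph, ident = ident Grph, cmp = cmp Grph,
     spine = K, proxy = P\<rparr>"

definition complete_graph_choice :: "(nat \<Rightarrow> 'v graph) \<Rightarrow> bool" where
  "complete_graph_choice K \<longleftrightarrow> (\<forall>n. is_complete_graph n (K n))"

definition pushout_choice :: "(nat \<Rightarrow> 'v graph)
    \<Rightarrow> ('v graph_arrow \<Rightarrow> 'v graph_arrow \<Rightarrow> ('v graph, 'v graph_arrow) cocone) \<Rightarrow> bool" where
  "pushout_choice K P \<longleftrightarrow> (\<forall>n g h. monomorphism Grph g \<longrightarrow> monomorphism Grph h \<longrightarrow>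
     src Grph g = K n \<longrightarrow> src Grph h = K n \<longrightarrow> is_pushout Grph g h (P g h))"

section \<open>The hypotheses on \<open>K\<close> and \<open>P\<close> are satisfiable\<close>

lemma Nat_cat_spined: "spined_category Nat_cat"
  by unfold_locales
    (auto simp: Nat_cat_def hom_def max_def Ex1_def split: if_splits)

lemma simple_graph_edge:
  assumes "simple_graph G" and "{u, v} \<in> edges G"
  shows "u \<in> verts G" and "v \<in> verts G" and "u \<noteq> v"
  using assms by (auto simp: simple_graph_def doubleton_eq_iff dest!: bspec)

lemma graph_arrow_eqI:
  fixes a b :: "'v graph_arrow"
  assumes "graph_hom a" and "graph_hom b" and "dom_graph a = dom_graph b"
    and "cod_graph a = cod_graph b"
    and "\<And>v. v \<in> verts (dom_graph a) \<Longrightarrow> vmap a v = vmap b v"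
  shows "a = b"
proof -
  have "vmap a = vmap b"
    using assms by (intro PiE_ext[of _ "verts (dom_graph a)"]) (auto simp: graph_hom_def)
  with assms show ?thesis by simp
qed

lemma category_Grph: "category (Grph :: ('v graph, 'v graph_arrow) cat)"
proof (unfold_locales, goal_cases)
  case (4 f X Y g Z)
  then show ?case
    by (auto simp: Grph_def hom_def graph_hom_def compose_def dest: simple_graph_edge)
      (meson PiE_mem)
next
  case (5 f X Y)
  then show ?case
    by (intro graph_arrow_eqI)
      (auto simp: Grph_def hom_def graph_hom_def compose_def dest: simple_graph_edge)
next
  case (6 f X Y)
  then show ?case
    by (intro graph_arrow_eqI)
      (auto simp: Grph_def hom_def graph_hom_def compose_def dest: simple_graph_edge)
next
  case (7 f W X g Y h Z)
  then show ?case
    by (auto simp: Grph_def hom_def graph_hom_def compose_def fun_eq_iff)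
qed (auto simp: Grph_def hom_def graph_hom_def dest: simple_graph_edge)

lemma monomorphism_Grph_iff:
  "monomorphism Grph f \<longleftrightarrow> graph_hom f \<and> inj_on (vmap f) (verts (dom_graph f))"
proof (intro iffI conjI inj_onI)
  assume m: "monomorphism Grph f"
  then show f: "graph_hom f" by (simp add: monomorphism_def Grph_def)
  fix u v
  assume u: "u \<in> verts (dom_graph f)" and v: "v \<in> verts (dom_graph f)"
    and eq: "vmap f u = vmap f v"
  define W where "W = \<lparr>verts = {u}, edges = {}\<rparr>"
  define pt where "pt x = \<lparr>dom_graph = W, vmap = (\<lambda>y\<in>{u}. x), cod_graph = dom_graph f\<rparr>" for x
  have "pt u \<in> hom Grph W (src Grph f)" "pt v \<in> hom Grph W (src Grph f)"
    using f u v by (auto simp: hom_def Grph_def graph_hom_def pt_def W_def simple_graph_def)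
  moreover have "cmp Grph f (pt u) = cmp Grph f (pt v)"
    using eq by (auto simp: Grph_def pt_def W_def compose_def fun_eq_iff)
  ultimately have "pt u = pt v" using m by (auto simp: monomorphism_def)
  then have "vmap (pt u) u = vmap (pt v) u" by simp
  then show "u = v" by (simp add: pt_def)
next
  assume f: "graph_hom f \<and> inj_on (vmap f) (verts (dom_graph f))"
  have "a = b" if a: "a \<in> hom Grph W (dom_graph f)" and b: "b \<in> hom Grph W (dom_graph f)"
    and eq: "cmp Grph f a = cmp Grph f b" for W a b
  proof (rule graph_arrow_eqI)
    fix v assume v: "v \<in> verts (dom_graph a)"
    have "vmap (cmp Grph f a) v = vmap (cmp Grph f b) v" using eq by simp
    moreover have "dom_graph a = W" "dom_graph b = W" using a b by (auto simp: hom_def Grph_def)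
    ultimately have "vmap f (vmap a v) = vmap f (vmap b v)"
      using v by (auto simp: Grph_def compose_def)
    moreover have "vmap a v \<in> verts (dom_graph f)" "vmap b v \<in> verts (dom_graph f)"
      using a b v by (auto simp: hom_def Grph_def graph_hom_def)
    ultimately show "vmap a v = vmap b v" using f by (auto dest: inj_onD)
  qed (use a b in \<open>auto simp: hom_def Grph_def\<close>)
  with f show "monomorphism Grph f" by (auto simp: monomorphism_def Grph_def)
qed

lemma pushout_exists:
  fixes g h :: "'v::infinite graph_arrow"
  assumes "monomorphism Grph g" and "monomorphism Grph h"
    and dom: "dom_graph g = X" "dom_graph h = X"
  shows "\<exists>c. is_pushout Grph g h c"
proof -
  define G H where GH_def: "G = cod_graph g" "H = cod_graph h"
  have g: "graph_hom g" "inj_on (vmap g) (verts X)" and h: "graph_hom h" "inj_on (vmap h) (verts X)"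
    using assms by (auto simp: monomorphism_Grph_iff)
  have sG: "simple_graph G" and sH: "simple_graph H" using g h by (auto simp: graph_hom_def GH_def)
  then have finG: "finite (verts G)" and finH: "finite (verts H)" by (auto simp: simple_graph_def)
  define I where "I = vmap h ` verts X"
  have gv: "vmap g x \<in> verts G" "vmap h x \<in> verts H" if "x \<in> verts X" for x
    using that g h dom by (auto simp: graph_hom_def GH_def)
  obtain \<phi> :: "nat \<Rightarrow> 'v" where \<phi>: "inj \<phi>" "range \<phi> \<subseteq> UNIV - verts G"
    using arb_countable_map[OF finG] by blast
  obtain \<nu> :: "'v \<Rightarrow> nat" where \<nu>: "inj_on \<nu> (verts H)"
    using finH by (meson finite_imp_inj_to_nat_seg)
  define k where "k w = (if w \<in> I then vmap g (inv_into (verts X) (vmap h) w) else \<phi> (\<nu> w))" for w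
  have k_h: "k (vmap h x) = vmap g x" if "x \<in> verts X" for x
    using that h by (auto simp: k_def I_def)
  have k_new: "k w \<notin> verts G" if "w \<notin> I" for w using that \<phi> by (auto simp: k_def)
  have k_old: "k w \<in> verts G" if "w \<in> I" for w using that gv k_h by (auto simp: I_def)
  have k_inj: "inj_on k (verts H)"
  proof (rule inj_onI)
    fix v w assume v: "v \<in> verts H" and w: "w \<in> verts H" and eq: "k v = k w"
    show "v = w"
    proof (cases "v \<in> I")
      case True
      then have "w \<in> I" using eq k_new k_old by metis
      with True eq show ?thesis using k_h g(2) by (auto simp: I_def dest: inj_onD)
    next
      case False
      then have "w \<notin> I" using eq k_new k_old by metis
      with False eq show ?thesis using \<phi>(1) \<nu> v w by (auto simp: k_def dest: injD inj_onD)
    qed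
  qed
  define Q where "Q = \<lparr>verts = verts G \<union> k ` verts H, edges = edges G \<union> (`) k ` edges H\<rparr>"
  have sQ: "simple_graph Q"
    unfolding simple_graph_def
  proof (intro conjI ballI)
    show "finite (verts Q)" using finG finH by (simp add: Q_def)
    fix e assume "e \<in> edges Q"
    then consider "e \<in> edges G" | e' where "e' \<in> edges H" "e = k ` e'" by (auto simp: Q_def)
    then show "\<exists>u\<in>verts Q. \<exists>v\<in>verts Q. u \<noteq> v \<and> e = {u, v}"
    proof cases
      case 1
      then obtain u v where "u \<in> verts G" "v \<in> verts G" "u \<noteq> v" "e = {u, v}"
        using sG unfolding simple_graph_def by blast
      moreover then have "u \<in> verts Q" "v \<in> verts Q" by (simp_all add: Q_def)
      ultimately show ?thesis by blast
    next
      case 2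
      then obtain u v where uv: "u \<in> verts H" "v \<in> verts H" "u \<noteq> v" "e' = {u, v}"
        using sH unfolding simple_graph_def by blast
      then have "k u \<noteq> k v" using k_inj by (auto dest: inj_onD)
      moreover have "k u \<in> verts Q" "k v \<in> verts Q" "e = {k u, k v}"
        using uv 2 by (auto simp: Q_def)
      ultimately show ?thesis by blast
    qed
  qed
  define i where "i = \<lparr>dom_graph = G, vmap = (\<lambda>v\<in>verts G. v), cod_graph = Q\<rparr>"
  define j where "j = \<lparr>dom_graph = H, vmap = (\<lambda>v\<in>verts H. k v), cod_graph = Q\<rparr>"
  have kedge: "{k u, k v} \<in> edges Q" if "{u, v} \<in> edges H" for u v
    using imageI[OF that, of "(`) k"] by (auto simp: Q_def)
  have i: "graph_hom i"
    unfolding graph_hom_def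
  proof (intro conjI allI impI)
    fix u v assume e: "{u, v} \<in> edges (dom_graph i)"
    then have "{u, v} \<in> edges G" by (simp add: i_def)
    then show "{vmap i u, vmap i v} \<in> edges (cod_graph i)"
      using simple_graph_edge[OF sG] by (simp add: i_def Q_def)
  qed (use sG sQ in \<open>auto simp: i_def Q_def\<close>)
  have j: "graph_hom j"
    unfolding graph_hom_def
  proof (intro conjI allI impI)
    fix u v assume e: "{u, v} \<in> edges (dom_graph j)"
    then have "{u, v} \<in> edges H" by (simp add: j_def)
    then show "{vmap j u, vmap j v} \<in> edges (cod_graph j)"
      using kedge simple_graph_edge[OF sH] by (simp add: j_def)
  qed (use sH sQ in \<open>auto simp: j_def Q_def\<close>)
  have comm: "cmp Grph i g = cmp Grph j h"
    using gv k_h by (auto simp: Grph_def i_def j_def compose_def dom fun_eq_iff)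
  have univ: "\<exists>!u. u \<in> hom Grph Q T \<and> cmp Grph u i = a \<and> cmp Grph u j = b"
    if a: "a \<in> hom Grph G T" and b: "b \<in> hom Grph H T" and ab: "cmp Grph a g = cmp Grph b h"
    for T a b
  proof -
    have a': "graph_hom a" "dom_graph a = G" "cod_graph a = T"
      and b': "graph_hom b" "dom_graph b = H" "cod_graph b = T"
      using a b by (auto simp: hom_def Grph_def)
    have aT: "vmap a v \<in> verts T" if "v \<in> verts G" for v
      using that a' by (auto simp: graph_hom_def)
    have bT: "vmap b v \<in> verts T" if "v \<in> verts H" for v
      using that b' by (auto simp: graph_hom_def)
    have aE: "{vmap a v, vmap a w} \<in> edges T" if "{v, w} \<in> edges G" for v w
      using that a' by (simp add: graph_hom_def)
    have bE: "{vmap b v, vmap b w} \<in> edges T" if "{v, w} \<in> edges H" for v w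
      using that b' by (simp add: graph_hom_def)
    have agb: "vmap a (vmap g x) = vmap b (vmap h x)" if "x \<in> verts X" for x
      using arg_cong[OF ab, of "\<lambda>f. vmap f x"] that by (simp add: Grph_def compose_def dom)
    define \<psi> where "\<psi> = (\<lambda>q\<in>verts Q. if q \<in> verts G then vmap a q
                                else vmap b (inv_into (verts H) k q))"
    have \<psi>G: "\<psi> q = vmap a q" if "q \<in> verts G" for q using that by (simp add: \<psi>_def Q_def)
    have \<psi>H: "\<psi> (k w) = vmap b w" if w: "w \<in> verts H" for w
    proof (cases "w \<in> I")
      case True
      then show ?thesis using \<psi>G[OF k_old[OF True]] agb k_h by (auto simp: I_def)
    next
      case False
      then show ?thesis using k_new[OF False] w k_inj by (auto simp: \<psi>_def Q_def)
    qed
    define u where "u = \<lparr>dom_graph = Q, vmap = \<psi>, cod_graph = T\<rparr>"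
    have "graph_hom u"
      unfolding graph_hom_def
    proof (intro conjI allI impI)
      show "simple_graph (dom_graph u)" "simple_graph (cod_graph u)"
        using sQ a' by (auto simp: u_def graph_hom_def)
      have "\<psi> q \<in> verts T" if "q \<in> verts Q" for q
        using that aT bT \<psi>G \<psi>H by (auto simp: Q_def)
      then show "vmap u \<in> verts (dom_graph u) \<rightarrow>\<^sub>E verts (cod_graph u)"
        by (auto simp: u_def \<psi>_def)
      fix p q assume "{p, q} \<in> edges (dom_graph u)"
      then consider "{p, q} \<in> edges G" | e' where "e' \<in> edges H" "{p, q} = k ` e'"
        by (auto simp: u_def Q_def)
      then show "{vmap u p, vmap u q} \<in> edges (cod_graph u)"
      proof cases
        case 1
        then show ?thesis
          using aE[OF 1] a' \<psi>G simple_graph_edge[OF sG 1] by (simp add: u_def)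
      next
        case 2
        then obtain v w where vw: "v \<in> verts H" "w \<in> verts H" "e' = {v, w}"
          using sH unfolding simple_graph_def by blast
        have "{vmap u p, vmap u q} = \<psi> ` {p, q}" by (simp add: u_def)
        also have "\<dots> = {vmap b v, vmap b w}" using 2 vw \<psi>H by simp
        also have "\<dots> \<in> edges T" using bE 2 vw by simp
        finally show ?thesis by (simp add: u_def)
      qed
    qed
    then have u: "u \<in> hom Grph Q T" by (simp add: hom_def Grph_def u_def)
    have i': "i \<in> hom Grph G Q" and j': "j \<in> hom Grph H Q"
      using i j by (simp_all add: hom_def Grph_def) (simp_all add: i_def j_def)
    have ui: "cmp Grph u i \<in> hom Grph G T" and uj: "cmp Grph u j \<in> hom Grph H T"
      using category.cmp_hom[OF category_Grph] u i' j' by blast+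
    have "cmp Grph u i = a"
    proof (rule graph_arrow_eqI)
      fix v assume "v \<in> verts (dom_graph (cmp Grph u i))"
      then show "vmap (cmp Grph u i) v = vmap a v"
        using \<psi>G by (simp add: Grph_def u_def i_def compose_def)
    qed (use ui a in \<open>auto simp: hom_def Grph_def\<close>)
    moreover have "cmp Grph u j = b"
    proof (rule graph_arrow_eqI)
      fix v assume "v \<in> verts (dom_graph (cmp Grph u j))"
      then show "vmap (cmp Grph u j) v = vmap b v"
        using \<psi>H by (simp add: Grph_def u_def j_def compose_def)
    qed (use uj b in \<open>auto simp: hom_def Grph_def\<close>)
    moreover have "t = u" if t: "t \<in> hom Grph Q T" "cmp Grph t i = a" "cmp Grph t j = b" for t
    proof (rule graph_arrow_eqI)
      show "graph_hom t" "dom_graph t = dom_graph u" "cod_graph t = cod_graph u"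
        using t by (auto simp: hom_def Grph_def u_def)
      fix v assume "v \<in> verts (dom_graph t)"
      then have v: "v \<in> verts G \<or> (\<exists>w \<in> verts H. v = k w)"
        using t by (auto simp: hom_def Grph_def Q_def)
      have tG: "vmap t v = vmap a v" if "v \<in> verts G" for v
        using arg_cong[OF t(2), of "\<lambda>f. vmap f v"] that by (simp add: Grph_def compose_def i_def)
      have tH: "vmap t (k w) = vmap b w" if "w \<in> verts H" for w
        using arg_cong[OF t(3), of "\<lambda>f. vmap f w"] that by (simp add: Grph_def compose_def j_def)
      show "vmap t v = vmap u v" using v tG tH \<psi>G \<psi>H by (auto simp: u_def)
    qed (fact \<open>graph_hom u\<close>)
    ultimately show ?thesis using u by blast
  qed
  have "is_pushout Grph g h \<lparr>apex = Q, left_leg = i, right_leg = j\<rparr>"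
    unfolding is_pushout_def
  proof (intro conjI allI ballI impI)
    show "cmp Grph (left_leg \<lparr>apex = Q, left_leg = i, right_leg = j\<rparr>) g =
        cmp Grph (right_leg \<lparr>apex = Q, left_leg = i, right_leg = j\<rparr>) h"
      using comm by simp
  next
    fix T a b
    assume "a \<in> hom Grph (tgt Grph g) T" "b \<in> hom Grph (tgt Grph h) T"
      "cmp Grph a g = cmp Grph b h"
    moreover have "tgt Grph g = G" "tgt Grph h = H" by (simp_all add: Grph_def GH_def)
    ultimately have "a \<in> hom Grph G T" "b \<in> hom Grph H T" "cmp Grph a g = cmp Grph b h"
      by simp_all
    from univ[OF this]
    show "\<exists>!u. u \<in> hom Grph (apex \<lparr>apex = Q, left_leg = i, right_leg = j\<rparr>) T \<and>
        cmp Grph u (left_leg \<lparr>apex = Q, left_leg = i, right_leg = j\<rparr>) = a \<and>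
        cmp Grph u (right_leg \<lparr>apex = Q, left_leg = i, right_leg = j\<rparr>) = b"
      by simp
  qed (use i j in \<open>simp_all add: hom_def Grph_def\<close>, simp_all add: i_def j_def GH_def)
  then show ?thesis by blast
qed

lemma choices_exist:
  "\<exists>(K :: nat \<Rightarrow> 'v::infinite graph) P. complete_graph_choice K \<and> pushout_choice K P"
proof -
  have "\<exists>G :: 'v graph. is_complete_graph n G" for n
  proof -
    obtain S :: "'v set" where "finite S" "card S = n"
      using infinite_arbitrarily_large[OF infinite_UNIV] by blast
    then have "is_complete_graph n \<lparr>verts = S, edges = {{u, v} | u v. u \<in> S \<and> v \<in> S \<and> u \<noteq> v}\<rparr>"
      by (auto simp: is_complete_graph_def complete_subgraph_def simple_graph_def)
    then show ?thesis ..
  qed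
  then obtain K :: "nat \<Rightarrow> 'v graph" where K: "\<And>n. is_complete_graph n (K n)" by metis
  have "pushout_choice K (\<lambda>g h. SOME c. is_pushout Grph g h c)"
    unfolding pushout_choice_def
  proof (intro allI impI)
    fix n g h
    assume "monomorphism Grph g" "monomorphism Grph h" "src Grph g = K n" "src Grph h = K n"
    then have "\<exists>c. is_pushout Grph g h c"
      using pushout_exists by (simp add: Grph_def)
    then show "is_pushout Grph g h (SOME c. is_pushout Grph g h c)" by (rule someI_ex)
  qed
  with K show ?thesis by (auto simp: complete_graph_choice_def)
qed

end

theory Submission
  imports Defs
begin

text \<open>Treewidth is itself an S-functor: chordal completions pull back along monomorphisms, and the
  union of chordal completions of two graphs glued along a clique is again chordal. Conversely, any
  two S-functors agree on chordal graphs, because a chordal graph that is not complete is glued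
  from two smaller chordal graphs along a clique, hence is a proxy pushout up to isomorphism.
  So chordal graphs are pseudo-chordal, which gives \<open>\<Delta> \<le> treewidth\<close>; and a monomorphism
  \<open>G \<rightarrow> H\<close> with \<open>H\<close> pseudo-chordal gives \<open>treewidth G \<le> treewidth H = s H\<close>, which is the other
  inequality.\<close>

section \<open>Graph embeddings\<close>

text \<open>Two points shape the proof. The choice \<open>P\<close> is arbitrary, and it is
  universal in \<open>Grph\<close>, among all homomorphisms, not in \<open>Grph_m\<close>. So the
  shape of a proxy pushout has to be extracted from its universal property, by test graphs for which
  the infinite vertex type leaves room, and mediating maps have to be shown injective separately.

  Second, functors into \<open>Nat_cat\<close> see objects only through inequalities. A graph glued
  along a clique is not literally a chosen apex, but embeddings in both directions already force
  equal values, so no isomorphism of graphs is ever constructed.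

  The clique number is an S-functor too, but as a lower bound for \<Delta> it is too weak: on the
  5-cycle it is 2, while treewidth is 3. Pseudo-chordality lets any \<open>s\<close> be replaced on
  \<open>H\<close> by treewidth, and monotonicity of treewidth then gives the sharp bound.\<close>

lemma simple_graph_edge_cases:
  assumes "simple_graph G" and "e \<in> edges G"
  obtains u v where "u \<in> verts G" "v \<in> verts G" "u \<noteq> v" "e = {u, v}"
  using assms unfolding simple_graph_def by blast

text \<open>Plain functions in place of \<open>graph_arrow\<close>: values off the vertex set are
  irrelevant, so composites, inclusions and inverses need no restriction, and source and target may
  have different vertex types.\<close>

definition graph_embedding :: "('v \<Rightarrow> 'w) \<Rightarrow> 'v graph \<Rightarrow> 'w graph \<Rightarrow> bool" where
  "graph_embedding f G H \<longleftrightarrow> inj_on f (verts G) \<and> f ` verts G \<subseteq> verts H \<and>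
     (\<forall>u v. {u, v} \<in> edges G \<longrightarrow> {f u, f v} \<in> edges H)"

lemma graph_embedding_comp:
  assumes "graph_embedding f G H" and "graph_embedding g H Q"
  shows "graph_embedding (g \<circ> f) G Q"
  unfolding graph_embedding_def
proof (intro conjI allI impI)
  show "inj_on (g \<circ> f) (verts G)"
    using assms unfolding graph_embedding_def by (meson comp_inj_on inj_on_subset)
qed (use assms in \<open>auto simp: graph_embedding_def image_subset_iff\<close>)

definition graph_union :: "'v graph \<Rightarrow> 'v graph \<Rightarrow> 'v graph" where
  "graph_union A B = \<lparr>verts = verts A \<union> verts B, edges = edges A \<union> edges B\<rparr>"

definition induced_subgraph :: "'v graph \<Rightarrow> 'v set \<Rightarrow> 'v graph" where
  "induced_subgraph G X = \<lparr>verts = verts G \<inter> X, edges = {e \<in> edges G. e \<subseteq> X}\<rparr>"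

definition graph_image :: "('v \<Rightarrow> 'w) \<Rightarrow> 'v graph \<Rightarrow> 'w graph" where
  "graph_image f G = \<lparr>verts = f ` verts G, edges = (`) f ` edges G\<rparr>"

definition complete_graph_on :: "'v set \<Rightarrow> 'v graph" where
  "complete_graph_on V = \<lparr>verts = V, edges = {{u, v} | u v. u \<in> V \<and> v \<in> V \<and> u \<noteq> v}\<rparr>"

lemma simple_graph_union:
  "simple_graph A \<Longrightarrow> simple_graph B \<Longrightarrow> simple_graph (graph_union A B)"
  unfolding simple_graph_def graph_union_def by fastforce

lemma simple_induced_subgraph: "simple_graph G \<Longrightarrow> simple_graph (induced_subgraph G X)"
  unfolding simple_graph_def induced_subgraph_def by fastforce

lemma simple_complete_graph_on: "finite V \<Longrightarrow> simple_graph (complete_graph_on V)"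
  unfolding simple_graph_def complete_graph_on_def by auto

lemma complete_graph_on_edge_iff:
  "{u, v} \<in> edges (complete_graph_on V) \<longleftrightarrow> u \<in> V \<and> v \<in> V \<and> u \<noteq> v"
  unfolding complete_graph_on_def by (auto simp: doubleton_eq_iff)

lemma simple_graph_image:
  assumes "simple_graph G" and "inj_on f (verts G)"
  shows "simple_graph (graph_image f G)"
  unfolding simple_graph_def
proof (intro conjI ballI)
  show "finite (verts (graph_image f G))"
    using assms by (simp add: simple_graph_def graph_image_def)
  fix e assume "e \<in> edges (graph_image f G)"
  then obtain e' where "e' \<in> edges G" "e = f ` e'" by (auto simp: graph_image_def)
  moreover then obtain u v where "u \<in> verts G" "v \<in> verts G" "u \<noteq> v" "e' = {u, v}"
    using assms(1) by (blast elim: simple_graph_edge_cases)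
  ultimately have "f u \<in> verts (graph_image f G)" "f v \<in> verts (graph_image f G)"
    "f u \<noteq> f v" "e = {f u, f v}"
    using assms(2) by (auto simp: graph_image_def dest: inj_onD)
  then show "\<exists>u\<in>verts (graph_image f G). \<exists>v\<in>verts (graph_image f G). u \<noteq> v \<and> e = {u, v}"
    by blast
qed

lemma graph_image_edge:
  assumes "simple_graph G" and "{p, q} \<in> edges (graph_image f G)"
  obtains u v where "{u, v} \<in> edges G" "u \<in> verts G" "v \<in> verts G" "p = f u" "q = f v"
proof -
  obtain e where e: "e \<in> edges G" "{p, q} = f ` e"
    using assms(2) by (auto simp: graph_image_def)
  then obtain u v where uv: "u \<in> verts G" "v \<in> verts G" "e = {u, v}"
    using assms(1) by (blast elim: simple_graph_edge_cases)
  then have "p = f u \<and> q = f v \<or> p = f v \<and> q = f u"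
    using e by (auto simp: doubleton_eq_iff)
  with uv e that show ?thesis by (metis insert_commute)
qed

lemma graph_embedding_image:
  assumes "inj_on f (verts G)"
  shows "graph_embedding f G (graph_image f G)"
  unfolding graph_embedding_def
proof (intro conjI allI impI)
  fix u v assume "{u, v} \<in> edges G"
  from imageI[OF this, of "(`) f"] show "{f u, f v} \<in> edges (graph_image f G)"
    by (simp add: graph_image_def)
qed (use assms in \<open>auto simp: graph_image_def\<close>)

lemma graph_embedding_inv_image:
  assumes "simple_graph G" and "inj_on f (verts G)"
  shows "graph_embedding (inv_into (verts G) f) (graph_image f G) G"
  unfolding graph_embedding_def
proof (intro conjI allI impI)
  show "inj_on (inv_into (verts G) f) (verts (graph_image f G))"
    by (simp add: graph_image_def inj_on_inv_into)
  show "inv_into (verts G) f ` verts (graph_image f G) \<subseteq> verts G"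
    using assms(2) by (auto simp: graph_image_def)
  fix p q assume "{p, q} \<in> edges (graph_image f G)"
  then obtain u v where "{u, v} \<in> edges G" "u \<in> verts G" "v \<in> verts G" "p = f u" "q = f v"
    using graph_image_edge[OF assms(1)] by metis
  then show "{inv_into (verts G) f p, inv_into (verts G) f q} \<in> edges G"
    using assms(2) by simp
qed

text \<open>In a complete target an edge could only fail by collapsing to a single vertex, which
  injectivity rules out.\<close>

lemma graph_embedding_complete:
  assumes "simple_graph G" and "inj_on f (verts G)" and "f ` verts G \<subseteq> verts H"
    and "complete_subgraph H (verts H)"
  shows "graph_embedding f G H"
  unfolding graph_embedding_def
proof (intro conjI allI impI)
  fix u v assume "{u, v} \<in> edges G"
  then have "u \<in> verts G" "v \<in> verts G" "u \<noteq> v" using simple_graph_edge[OF assms(1)] by auto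
  moreover then have "f u \<noteq> f v" using assms(2) by (auto dest: inj_onD)
  ultimately show "{f u, f v} \<in> edges H"
    using assms(3,4) by (auto simp: complete_subgraph_def)
qed (use assms in auto)

section \<open>Chordal graphs\<close>

text \<open>A cycle is carried along \<open>f\<close> to a cycle of the same length, and a chord is
  a pair of positions, so a chord of the image is a chord of the original as soon as
  \<open>f\<close> reflects edges. This serves both induced subgraphs and completions pulled back
  along a monomorphism.\<close>

lemma chordal_full_embedding:
  assumes inj: "inj_on f (verts G)" and sub: "f ` verts G \<subseteq> verts H"
    and iff: "\<And>u v. u \<in> verts G \<Longrightarrow> v \<in> verts G \<Longrightarrow> {f u, f v} \<in> edges H \<longleftrightarrow> {u, v} \<in> edges G"
    and H: "chordal H"
  shows "chordal G"
  unfolding chordal_def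
proof (intro allI impI)
  fix xs assume c: "is_cycle G xs" and len: "3 < length xs"
  then have in_G: "xs ! i \<in> verts G" if "i < length xs" for i
    using that by (auto simp: is_cycle_def)
  have lt: "Suc i mod length xs < length xs" for i using len by (intro mod_less_divisor) linarith
  have "is_cycle H (map f xs)"
    using c sub unfolding is_cycle_def
    by (auto simp: distinct_map lt iff in_G intro: inj_on_subset[OF inj])
  then have "has_chord H (map f xs)" using H len by (simp add: chordal_def)
  then obtain i j where "i < length xs" "j < length xs" "i \<noteq> j" "j \<noteq> Suc i mod length xs"
    "i \<noteq> Suc j mod length xs" "{map f xs ! i, map f xs ! j} \<in> edges H"
    unfolding has_chord_def length_map by blast
  moreover from this have "{xs ! i, xs ! j} \<in> edges G" using iff in_G by simp
  ultimately show "has_chord G xs" unfolding has_chord_def by blast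
qed

lemma chordal_induced_subgraph:
  "chordal G \<Longrightarrow> chordal (induced_subgraph G X)"
  by (rule chordal_full_embedding[of "\<lambda>x. x"]) (auto simp: induced_subgraph_def)

lemma chordal_complete:
  assumes "complete_subgraph G (verts G)"
  shows "chordal G"
  unfolding chordal_def
proof (intro allI impI)
  fix xs assume c: "is_cycle G xs" and len: "3 < length xs"
  have lt: "0 < length xs" "2 < length xs" using len by linarith+
  have "distinct xs" and sub: "set xs \<subseteq> verts G" using c by (simp_all only: is_cycle_def)
  then have "xs ! 0 \<noteq> xs ! 2" using lt by (simp add: nth_eq_iff_index_eq)
  moreover have "xs ! 0 \<in> verts G" "xs ! 2 \<in> verts G" using sub nth_mem lt by blast+
  ultimately have e: "{xs ! 0, xs ! 2} \<in> edges G"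
    using assms unfolding complete_subgraph_def by blast
  \<comment> \<open>Length at least 4 means that position 3 does not wrap to 0, so positions 0 and 2
    are not consecutive in either direction.\<close>
  have "Suc 0 mod length xs = Suc 0" by (rule mod_less) (use len in linarith)
  moreover have "Suc 2 mod length xs = Suc 2" by (rule mod_less) (use len in linarith)
  ultimately show "has_chord G xs"
    unfolding has_chord_def using lt e by (intro exI[of _ 0] exI[of _ 2] conjI) simp_all
qed

lemma last_before_change:
  fixes i j :: nat
  assumes "Q i" and "\<not> Q j" and "i < j"
  shows "\<exists>k. i \<le> k \<and> k < j \<and> Q k \<and> \<not> Q (Suc k)"
proof (rule ccontr)
  assume "\<not> ?thesis"
  then have *: "Q (Suc k)" if "i \<le> k" "k < j" "Q k" for k using that by blast
  have "k \<le> j \<longrightarrow> Q k" if "i \<le> k" for k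
    using that by (induction k rule: dec_induct) (use assms * in auto)
  with assms show False by simp
qed

text \<open>No edge joins a vertex outside \<open>B\<close> to a vertex outside \<open>A\<close>. A
  cycle with vertices of both kinds therefore meets the common clique on each of its two arcs
  between them, and two such meeting points span a chord. A cycle without vertices of both kinds
  lies within one side.\<close>

lemma chordal_graph_union:
  assumes sA: "simple_graph A" and sB: "simple_graph B"
    and chA: "chordal A" and chB: "chordal B"
    and cA: "complete_subgraph A (verts A \<inter> verts B)"
    and cB: "complete_subgraph B (verts A \<inter> verts B)"
  shows "chordal (graph_union A B)"
  unfolding chordal_def
proof (intro allI impI)
  fix xs assume c: "is_cycle (graph_union A B) xs" and len: "3 < length xs"
  let ?n = "length xs"
  have dist: "distinct xs" and vs: "set xs \<subseteq> verts A \<union> verts B"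
    and es: "\<And>i. i < ?n \<Longrightarrow> {xs ! i, xs ! (Suc i mod ?n)} \<in> edges A \<union> edges B"
    using c by (auto simp: is_cycle_def graph_union_def)
  \<comment> \<open>An edge of \<open>B\<close> with both ends in \<open>A\<close> lies in the
    common clique, so \<open>A\<close> has it too.\<close>
  have edgeA: "e \<in> edges A" if "e \<in> edges A \<union> edges B" "e \<subseteq> verts A" for e
  proof (cases "e \<in> edges A")
    case False
    then have "e \<in> edges B" using that by blast
    then obtain u v where "u \<in> verts B" "v \<in> verts B" "u \<noteq> v" "e = {u, v}"
      by (rule simple_graph_edge_cases[OF sB])
    with that cA show ?thesis by (auto simp: complete_subgraph_def)
  qed
  have edgeB: "e \<in> edges B" if "e \<in> edges A \<union> edges B" "e \<subseteq> verts B" for e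
  proof (cases "e \<in> edges B")
    case False
    then have "e \<in> edges A" using that by blast
    then obtain u v where "u \<in> verts A" "v \<in> verts A" "u \<noteq> v" "e = {u, v}"
      by (rule simple_graph_edge_cases[OF sA])
    with that cB show ?thesis by (auto simp: complete_subgraph_def)
  qed
  have lt: "k mod ?n < ?n" for k using len by (intro mod_less_divisor) linarith
  show "has_chord (graph_union A B) xs"
  proof (cases "set xs \<subseteq> verts A \<or> set xs \<subseteq> verts B")
    case True
    then show ?thesis
    proof
      assume sub: "set xs \<subseteq> verts A"
      have "{xs ! i, xs ! (Suc i mod ?n)} \<in> edges A" if "i < ?n" for i
        using es[OF that] sub nth_mem[OF that] nth_mem[OF lt] by (intro edgeA) auto
      with sub have "is_cycle A xs"
        using dist len unfolding is_cycle_def by simp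
      then have "has_chord A xs" using chA len by (simp add: chordal_def)
      moreover have "edges A \<subseteq> edges (graph_union A B)" by (simp add: graph_union_def)
      ultimately show ?thesis unfolding has_chord_def by blast
    next
      assume sub: "set xs \<subseteq> verts B"
      have "{xs ! i, xs ! (Suc i mod ?n)} \<in> edges B" if "i < ?n" for i
        using es[OF that] sub nth_mem[OF that] nth_mem[OF lt] by (intro edgeB) auto
      with sub have "is_cycle B xs"
        using dist len unfolding is_cycle_def by simp
      then have "has_chord B xs" using chB len by (simp add: chordal_def)
      moreover have "edges B \<subseteq> edges (graph_union A B)" by (simp add: graph_union_def)
      ultimately show ?thesis unfolding has_chord_def by blast
    qed
  next
    case False
    \<comment> \<open>The cycle unrolled periodically: an arc that passes the end of the list
      becomes an ordinary interval of indices.\<close>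
    define f where "f k = xs ! (k mod ?n)" for k
    have f_vert: "f k \<in> verts A \<union> verts B" for k
      using vs nth_mem[OF lt] by (auto simp: f_def)
    have f_edge: "{f k, f (Suc k)} \<in> edges A \<union> edges B" for k
      using es[OF lt[of k]] by (simp add: f_def mod_Suc_eq)
    have stepA: "f (Suc k) \<in> verts A" if "f k \<in> verts A - verts B" for k
      using f_edge[of k] that simple_graph_edge[OF sA] simple_graph_edge[OF sB] by blast
    have stepB: "f (Suc k) \<in> verts B" if "f k \<in> verts B - verts A" for k
      using f_edge[of k] that simple_graph_edge[OF sA] simple_graph_edge[OF sB] by blast
    have crossAB: "\<exists>p. i < p \<and> p < j \<and> f p \<in> verts A \<inter> verts B"
      if h: "f i \<in> verts A - verts B" "f j \<in> verts B - verts A" "i < j" for i j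
    proof -
      obtain k where k: "i \<le> k" "k < j" "f k \<in> verts A - verts B" "\<not> f (Suc k) \<in> verts A - verts B"
        using last_before_change[of "\<lambda>k. f k \<in> verts A - verts B" i j] h by blast
      then have "f (Suc k) \<in> verts A \<inter> verts B" using stepA by blast
      moreover then have "Suc k \<noteq> j" using h by blast
      ultimately show ?thesis using k by (intro exI[of _ "Suc k"]) auto
    qed
    have crossBA: "\<exists>p. i < p \<and> p < j \<and> f p \<in> verts A \<inter> verts B"
      if h: "f i \<in> verts B - verts A" "f j \<in> verts A - verts B" "i < j" for i j
    proof -
      obtain k where k: "i \<le> k" "k < j" "f k \<in> verts B - verts A" "\<not> f (Suc k) \<in> verts B - verts A"
        using last_before_change[of "\<lambda>k. f k \<in> verts B - verts A" i j] h by blast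
      then have "f (Suc k) \<in> verts A \<inter> verts B" using stepB by blast
      moreover then have "Suc k \<noteq> j" using h by blast
      ultimately show ?thesis using k by (intro exI[of _ "Suc k"]) auto
    qed
    obtain i j where ij: "i < ?n" "j < ?n" "xs ! i \<in> verts A - verts B" "xs ! j \<in> verts B - verts A"
      using False vs unfolding subset_iff in_set_conv_nth by blast
    have per: "f (k + ?n) = f k" for k by (simp add: f_def)
    have fi: "f i \<in> verts A - verts B" "f (i + ?n) \<in> verts A - verts B"
      and fj: "f j \<in> verts B - verts A" "f (j + ?n) \<in> verts B - verts A"
      using ij unfolding per by (simp_all add: f_def)
    \<comment> \<open>\<open>a\<close> and \<open>b\<close> are the indices \<open>i\<close> and
      \<open>j\<close> in increasing order, on opposite sides of the gluing. The crossing
      \<open>p\<close> lies between \<open>a\<close> and \<open>b\<close>, the crossing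
      \<open>q\<close> between \<open>b\<close> and the next copy \<open>a + ?n\<close>.\<close>
    have "\<exists>a p b q. a < p \<and> p < b \<and> b < q \<and> q < a + ?n \<and> b < ?n \<and>
        f p \<in> verts A \<inter> verts B \<and> f q \<in> verts A \<inter> verts B"
    proof (cases "i < j")
      case True
      then obtain p q where "i < p" "p < j" "j < q" "q < i + ?n"
        "f p \<in> verts A \<inter> verts B" "f q \<in> verts A \<inter> verts B"
        using crossAB[OF fi(1) fj(1)] crossBA[OF fj(1) fi(2)] ij by auto
      with ij show ?thesis by blast
    next
      case False
      moreover have "i \<noteq> j" using ij by blast
      ultimately obtain p q where "j < p" "p < i" "i < q" "q < j + ?n"
        "f p \<in> verts A \<inter> verts B" "f q \<in> verts A \<inter> verts B"
        using crossBA[OF fj(1) fi(1)] crossAB[OF fi(1) fj(2)] ij by auto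
      with ij show ?thesis by blast
    qed
    then obtain a p b q where pq: "a < p" "p < b" "b < q" "q < a + ?n" "b < ?n"
      "f p \<in> verts A \<inter> verts B" "f q \<in> verts A \<inter> verts B" by blast
    define q' where "q' = q mod ?n"
    have p: "p < ?n" and q': "q' < ?n" using pq lt by (auto simp: q'_def)
    \<comment> \<open>From \<open>q < a + ?n\<close> and \<open>a < ?n\<close>, reducing
      \<open>q\<close> subtracts \<open>?n\<close> at most once.\<close>
    have q'_cases: "q' = q \<and> q < ?n \<or> q' + ?n = q"
    proof (cases "q < ?n")
      case False
      then have "q' = q - ?n" using pq unfolding q'_def by (subst le_mod_geq) auto
      with False show ?thesis by simp
    qed (simp add: q'_def)
    \<comment> \<open>Going round from \<open>p\<close> to \<open>q\<close> one passes
      \<open>b\<close>, and from \<open>q\<close> to \<open>p + ?n\<close> one passes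
      \<open>a + ?n\<close>; both are strictly in between, so the two positions are distinct and not
      consecutive.\<close>
    have ne: "p \<noteq> q'" "q' \<noteq> Suc p mod ?n" "p \<noteq> Suc q' mod ?n"
      using q'_cases pq p q' by (auto simp: mod_Suc)
    have fpq: "f p = xs ! p" "f q = xs ! q'" using p by (simp_all add: f_def q'_def)
    have "xs ! p \<noteq> xs ! q'" using dist p q' ne(1) by (simp add: nth_eq_iff_index_eq)
    then have "{xs ! p, xs ! q'} \<in> edges (graph_union A B)"
      using pq(6,7) cA unfolding fpq by (auto simp: complete_subgraph_def graph_union_def)
    with p q' ne show ?thesis unfolding has_chord_def by blast
  qed
qed

section \<open>Clique separators in chordal graphs\<close>

definition adj_on :: "'v graph \<Rightarrow> 'v set \<Rightarrow> 'v rel" where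
  "adj_on G A = {(u, v). u \<in> A \<and> v \<in> A \<and> {u, v} \<in> edges G}"

definition connected_in :: "'v graph \<Rightarrow> 'v set \<Rightarrow> bool" where
  "connected_in G A \<longleftrightarrow> (\<forall>a \<in> A. \<forall>b \<in> A. (a, b) \<in> (adj_on G A)\<^sup>*)"

lemma adj_on_mono: "A \<subseteq> B \<Longrightarrow> adj_on G A \<subseteq> adj_on G B"
  by (auto simp: adj_on_def)

lemma connected_in_insert:
  assumes A: "connected_in G A" and a: "a \<in> A" "{a, b} \<in> edges G"
  shows "connected_in G (insert b A)"
proof -
  have sub: "(adj_on G A)\<^sup>* \<subseteq> (adj_on G (insert b A))\<^sup>*"
    by (intro rtrancl_mono adj_on_mono) auto
  have ab: "(a, b) \<in> adj_on G (insert b A)" "(b, a) \<in> adj_on G (insert b A)"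
    using a by (auto simp: adj_on_def insert_commute)
  have "(x, a) \<in> (adj_on G (insert b A))\<^sup>* \<and> (a, x) \<in> (adj_on G (insert b A))\<^sup>*"
    if "x \<in> insert b A" for x
    using that ab A a sub unfolding connected_in_def by blast
  then show ?thesis unfolding connected_in_def by (meson rtrancl_trans)
qed

text \<open>A shortest walk from \<open>x\<close> to \<open>y\<close> through \<open>A\<close> is an induced path, and \<open>c\<close> closes it up to
  a cycle whose only possible chord is \<open>{x, y}\<close>.\<close>

lemma chordal_neighbours_adjacent:
  assumes sG: "simple_graph G" and ch: "chordal G" and A: "connected_in G A" "A \<subseteq> verts G"
    and xy: "x \<in> verts G - A" "y \<in> verts G - A" "x \<noteq> y"
    and ax: "a \<in> A" "{x, a} \<in> edges G" and by': "b \<in> A" "{b, y} \<in> edges G"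
    and c: "c \<in> verts G - A" "{c, x} \<in> edges G" "{y, c} \<in> edges G"
    and cA: "\<And>a. a \<in> A \<Longrightarrow> {c, a} \<notin> edges G"
  shows "{x, y} \<in> edges G"
proof (rule ccontr)
  assume nxy: "{x, y} \<notin> edges G"
  \<comment> \<open>The walk may use \<open>x\<close> and \<open>y\<close> as well as
    \<open>A\<close>; that its interior stays in \<open>A\<close> follows later, because a shortest
    walk does not revisit its ends.\<close>
  define R where "R = adj_on G (insert x (insert y A))"
  have "(x, a) \<in> R" "(b, y) \<in> R" using ax by' by (auto simp: R_def adj_on_def)
  moreover have "(a, b) \<in> R\<^sup>*"
    using A ax by' rtrancl_mono[OF adj_on_mono[of A "insert x (insert y A)" G]]
    by (auto simp: connected_in_def R_def)
  ultimately have "(x, y) \<in> R\<^sup>*" by (meson converse_rtrancl_into_rtrancl rtrancl.rtrancl_into_rtrancl)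
  then have ex: "\<exists>n. (x, y) \<in> R ^^ n" by (simp add: rtrancl_power)
  define n where "n = (LEAST n. (x, y) \<in> R ^^ n)"
  have n: "(x, y) \<in> R ^^ n" unfolding n_def using ex by (rule LeastI_ex)
  have least: "n \<le> m" if "(x, y) \<in> R ^^ m" for m unfolding n_def using that by (rule Least_le)
  obtain f where f: "f 0 = x" "f n = y" and fR: "\<And>i. i < n \<Longrightarrow> (f i, f (Suc i)) \<in> R"
    using n unfolding relpow_fun_conv by blast
  have seg: "(f i, f j) \<in> R ^^ (j - i)" if "i \<le> j" "j \<le> n" for i j
    unfolding relpow_fun_conv
    using that fR by (intro exI[of _ "\<lambda>k. f (i + k)"]) auto
  \<comment> \<open>A repeated vertex, or below an edge between non-consecutive vertices, would cut
    out part of the walk and contradict the minimality of \<open>n\<close>.\<close>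
  have neq: "f i \<noteq> f j" if "i < j" "j \<le> n" for i j
  proof
    assume "f i = f j"
    then have "(x, y) \<in> R ^^ i O R ^^ (n - j)"
      using seg[of 0 i] seg[of j n] that f by auto
    then have "(x, y) \<in> R ^^ (i + (n - j))" by (simp only: relpow_add)
    from least[OF this] that show False by simp
  qed
  have nonadj: "{f i, f j} \<notin> edges G" if "Suc i < j" "j \<le> n" "f i \<in> insert x (insert y A)"
    "f j \<in> insert x (insert y A)" for i j
  proof
    assume "{f i, f j} \<in> edges G"
    then have "(f i, f j) \<in> R" using that by (simp add: R_def adj_on_def)
    then have "(x, y) \<in> R ^^ i O R O R ^^ (n - j)"
      using seg[of 0 i] seg[of j n] that f by auto
    then have "(x, y) \<in> R ^^ (i + (1 + (n - j)))" by (simp only: relpow_add relpow_1)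
    from least[OF this] that show False by simp
  qed
  have f_in: "f i \<in> insert x (insert y A)" if "i \<le> n" for i
    using that fR[of i] f by (cases "i = n") (auto simp: R_def adj_on_def)
  have f_A: "f i \<in> A" if "0 < i" "i < n" for i
    using f_in[of i] neq[of 0 i] neq[of i n] that f by auto
  have "n \<noteq> 0" using f xy by metis
  \<comment> \<open>The assumed non-adjacency of \<open>x\<close> and \<open>y\<close> enters here;
    it makes the closed walk with \<open>c\<close> longer than a triangle.\<close>
  moreover have "n \<noteq> 1" using fR[of 0] f nxy by (auto simp: R_def adj_on_def)
  ultimately have n2: "2 \<le> n" by simp
  define xs where "xs = map f [0..<Suc n] @ [c]"
  have len: "length xs = n + 2" by (simp add: xs_def)
  have nth: "xs ! i = f i" if "i \<le> n" for i
    using that unfolding xs_def by (subst nth_append) (auto simp del: upt_Suc)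
  have nth_c: "xs ! Suc n = c" unfolding xs_def by (subst nth_append) (simp del: upt_Suc)
  have cxy: "c \<noteq> x" "c \<noteq> y" using c simple_graph_edge[OF sG] by blast+
  have "is_cycle G xs"
    unfolding is_cycle_def
  proof (intro conjI allI impI)
    show "distinct xs"
    proof -
      have "inj_on f {0..<Suc n}"
        by (intro linorder_inj_onI) (use neq in auto)
      moreover have "c \<noteq> f i" if "i \<le> n" for i
        using f_in[OF that] cxy c(1) by blast
      then have "c \<notin> f ` {0..<Suc n}" unfolding image_iff by (metis atLeastLessThan_iff less_Suc_eq_le)
      ultimately show ?thesis
        unfolding xs_def distinct_append distinct_map set_map set_upt by (simp del: upt_Suc)
    qed
    show "set xs \<subseteq> verts G"
    proof -
      have "f i \<in> verts G" if "i \<le> n" for i using f_in[OF that] xy A by blast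
      with c show ?thesis unfolding xs_def by (auto simp del: upt_Suc)
    qed
    fix i assume "i < length xs"
    then consider "i < n" | "i = n" | "i = Suc n" unfolding len by linarith
    then show "{xs ! i, xs ! (Suc i mod length xs)} \<in> edges G"
    proof cases
      case 1
      then show ?thesis using fR[of i] by (simp add: nth len R_def adj_on_def)
    next
      case 2
      then show ?thesis using c f by (simp add: nth nth_c len)
    next
      case 3
      then show ?thesis using c f by (simp add: nth nth_c len)
    qed
  qed (use n2 len in linarith)
  then have "has_chord G xs" using ch n2 len by (simp add: chordal_def)
  then obtain i j where ij: "i < n + 2" "j < n + 2" "i \<noteq> j" "j \<noteq> Suc i mod (n + 2)"
    "i \<noteq> Suc j mod (n + 2)" "{xs ! i, xs ! j} \<in> edges G"
    unfolding has_chord_def len by blast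
  \<comment> \<open>With the order of the two positions fixed, a chord at \<open>c\<close> would end
    in an interior vertex of the walk, hence in \<open>A\<close>, against \<open>cA\<close>; any
    other chord is a shortcut of the walk.\<close>
  have *: False if "i < j" "j < n + 2" "j \<noteq> Suc i" "i \<noteq> Suc j mod (n + 2)"
    "{xs ! i, xs ! j} \<in> edges G" for i j
  proof (cases "j = Suc n")
    case True
    then have "0 < i" "i < n" using that by auto
    then show False using that cA[OF f_A] True by (simp add: nth nth_c insert_commute)
  next
    case False
    then show False using that nonadj[of i j] f_in by (auto simp: nth)
  qed
  show False
  proof (cases "i < j")
    case True
    then show False using *[of i j] ij by auto
  next
    case False
    then show False using *[of j i] ij by (auto simp: insert_commute)
  qed
qed

text \<open>Take \<open>A\<close> maximal among the connected sets that do not dominate \<open>G\<close>. By maximality every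
  vertex outside \<open>A \<union> N(A)\<close> is adjacent to all of \<open>N(A)\<close>, which makes \<open>N(A)\<close> a clique.\<close>

lemma chordal_clique_separation:
  assumes sG: "simple_graph G" and ch: "chordal G" and nc: "\<not> complete_subgraph G (verts G)"
  obtains X Y where "X \<union> Y = verts G" "X \<subset> verts G" "Y \<subset> verts G" "complete_subgraph G (X \<inter> Y)"
    "\<And>x y. x \<in> X - Y \<Longrightarrow> y \<in> Y - X \<Longrightarrow> {x, y} \<notin> edges G"
proof -
  define N where "N A = {v \<in> verts G - A. \<exists>a \<in> A. {a, v} \<in> edges G}" for A
  define \<F> where "\<F> = {A. A \<subseteq> verts G \<and> A \<noteq> {} \<and> connected_in G A \<and> A \<union> N A \<noteq> verts G}"
  \<comment> \<open>A non-edge starts the maximality argument: the singleton \<open>{u}\<close> is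
    connected and does not dominate \<open>v\<close>.\<close>
  obtain u v where uv: "u \<in> verts G" "v \<in> verts G" "u \<noteq> v" "{u, v} \<notin> edges G"
    using nc by (auto simp: complete_subgraph_def)
  then have "{u} \<in> \<F>" by (auto simp: \<F>_def N_def connected_in_def)
  moreover have "finite \<F>"
    using sG by (auto simp: \<F>_def simple_graph_def intro: finite_subset[of _ "Pow (verts G)"])
  ultimately obtain A where A: "A \<in> \<F>" and max: "\<And>A'. A' \<in> \<F> \<Longrightarrow> A \<subseteq> A' \<Longrightarrow> A = A'"
    using finite_has_maximal[of \<F>] by blast
  have Asub: "A \<subseteq> verts G" and Ane: "A \<noteq> {}" and Aconn: "connected_in G A"
    and Adom: "A \<union> N A \<noteq> verts G"
    using A by (auto simp: \<F>_def)
  define C where "C = verts G - A - N A"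
  \<comment> \<open>If \<open>b\<close> missed \<open>c\<close>, then \<open>insert b A\<close>
    would still be connected and still fail to dominate \<open>c\<close>, against
    maximality.\<close>
  have NC: "{b, c} \<in> edges G" if b: "b \<in> N A" and c: "c \<in> C" for b c
  proof (rule ccontr)
    assume nbc: "{b, c} \<notin> edges G"
    obtain a where "a \<in> A" "{a, b} \<in> edges G" using b by (auto simp: N_def)
    then have "connected_in G (insert b A)" using Aconn by (rule connected_in_insert[rotated])
    moreover have "c \<notin> insert b A \<union> N (insert b A)"
      using b c nbc by (auto simp: C_def N_def)
    ultimately have "insert b A \<in> \<F>"
      using b c Asub by (auto simp: \<F>_def N_def C_def)
    then have "A = insert b A" using max by blast
    with b show False by (auto simp: N_def)
  qed
  obtain c where c: "c \<in> C" using Adom Asub by (auto simp: C_def N_def)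
  \<comment> \<open>Any undominated \<open>c\<close> closes up the paths through \<open>A\<close>.
    When \<open>G\<close> is disconnected, \<open>N A\<close> may be empty; the gluing is then along
    the empty clique.\<close>
  have "complete_subgraph G (N A)"
    unfolding complete_subgraph_def
  proof (intro conjI ballI impI)
    fix x y assume xy: "x \<in> N A" "y \<in> N A" "x \<noteq> y"
    then obtain a b where ab: "a \<in> A" "{x, a} \<in> edges G" "b \<in> A" "{b, y} \<in> edges G"
      unfolding N_def by (auto simp: insert_commute)
    show "{x, y} \<in> edges G"
    proof (rule chordal_neighbours_adjacent[OF sG ch Aconn Asub])
      show "{c, x} \<in> edges G" "{y, c} \<in> edges G"
        using NC[OF xy(1) c] NC[OF xy(2) c] by (simp_all only: insert_commute)
      show "{c, a'} \<notin> edges G" if "a' \<in> A" for a'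
        using that c by (auto simp: C_def N_def insert_commute)
    qed (use xy ab c in \<open>auto simp: N_def C_def\<close>)
  qed (auto simp: N_def)
  moreover have "(A \<union> N A) \<inter> (N A \<union> C) = N A" by (auto simp: N_def C_def)
  moreover have "{x, y} \<notin> edges G" if "x \<in> (A \<union> N A) - (N A \<union> C)" "y \<in> (N A \<union> C) - (A \<union> N A)" for x y
    using that by (auto simp: C_def N_def)
  moreover have "(A \<union> N A) \<union> (N A \<union> C) = verts G" using Asub by (auto simp: C_def N_def)
  moreover have "A \<union> N A \<subset> verts G" using c Asub by (auto simp: C_def N_def)
  moreover have "N A \<union> C \<subset> verts G" using Ane Asub by (auto simp: C_def N_def)
  ultimately show ?thesis using that[of "A \<union> N A" "N A \<union> C"] by metis
qed

section \<open>Treewidth\<close>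

lemma complete_subgraph_subset: "complete_subgraph G S \<Longrightarrow> T \<subseteq> S \<Longrightarrow> complete_subgraph G T"
  unfolding complete_subgraph_def by blast

lemma finite_clique_cards:
  assumes "simple_graph G"
  shows "finite {card S | S. complete_subgraph G S}"
proof -
  have "{card S | S. complete_subgraph G S} \<subseteq> card ` Pow (verts G)"
    by (auto simp: complete_subgraph_def)
  then show ?thesis using assms by (simp add: simple_graph_def finite_subset)
qed

lemma card_le_clique_number:
  assumes "simple_graph G" and "complete_subgraph G S"
  shows "card S \<le> clique_number G"
  unfolding clique_number_def using assms finite_clique_cards by (intro Max_ge) auto

lemma clique_number_attained:
  assumes "simple_graph G"
  obtains S where "complete_subgraph G S" "card S = clique_number G"
proof -
  \<comment> \<open>The empty clique keeps the set nonempty, so that \<open>Max\<close> is attained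
    even for the graph without vertices.\<close>
  have "complete_subgraph G {}" by (simp add: complete_subgraph_def)
  then have "{card S | S. complete_subgraph G S} \<noteq> {}" by blast
  from Max_in[OF finite_clique_cards[OF assms] this] show ?thesis
    using that by (auto simp: clique_number_def)
qed

lemma complete_subgraph_image:
  assumes "graph_embedding f G H" and "complete_subgraph G S"
  shows "complete_subgraph H (f ` S)"
  unfolding complete_subgraph_def
proof (intro conjI ballI impI)
  show "f ` S \<subseteq> verts H"
    using assms unfolding complete_subgraph_def graph_embedding_def image_subset_iff by blast
  fix p q assume "p \<in> f ` S" "q \<in> f ` S" "p \<noteq> q"
  then obtain u v where "u \<in> S" "v \<in> S" "u \<noteq> v" "p = f u" "q = f v" by blast
  then show "{p, q} \<in> edges H"
    using assms by (simp add: complete_subgraph_def graph_embedding_def)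
qed

lemma clique_number_mono:
  assumes "simple_graph G" and "simple_graph H" and emb: "graph_embedding f G H"
  shows "clique_number G \<le> clique_number H"
proof -
  obtain S where S: "complete_subgraph G S" "card S = clique_number G"
    using assms(1) by (rule clique_number_attained)
  then have "inj_on f S"
    using emb unfolding complete_subgraph_def graph_embedding_def by (meson inj_on_subset)
  then show ?thesis
    using card_le_clique_number[OF assms(2) complete_subgraph_image[OF emb S(1)]] S(2)
    by (simp add: card_image)
qed

text \<open>A clique of the union cannot contain both a vertex outside \<open>A\<close> and one
  outside \<open>B\<close>, since these are not adjacent. So it lies on one side, and its edges
  coming from the other side belong to the shared clique.\<close>

lemma clique_number_graph_union:
  assumes sA: "simple_graph A" and sB: "simple_graph B"
    and cA: "complete_subgraph A (verts A \<inter> verts B)"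
    and cB: "complete_subgraph B (verts A \<inter> verts B)"
  shows "clique_number (graph_union A B) \<le> max (clique_number A) (clique_number B)"
proof -
  obtain S where S: "complete_subgraph (graph_union A B) S"
    "card S = clique_number (graph_union A B)"
    using simple_graph_union[OF sA sB] by (rule clique_number_attained)
  have "S \<subseteq> verts A \<or> S \<subseteq> verts B"
  proof (rule ccontr)
    assume "\<not> ?thesis"
    then obtain x y where xy: "x \<in> S" "x \<notin> verts A" "y \<in> S" "y \<notin> verts B" by blast
    then have "x \<noteq> y" using S by (auto simp: complete_subgraph_def graph_union_def)
    then have "{x, y} \<in> edges A \<union> edges B"
      using S xy by (simp add: complete_subgraph_def graph_union_def)
    then show False using xy simple_graph_edge[OF sA] simple_graph_edge[OF sB] by blast
  qed
  then show ?thesis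
  proof
    assume sub: "S \<subseteq> verts A"
    have "{x, y} \<in> edges A" if "x \<in> S" "y \<in> S" "x \<noteq> y" for x y
    proof -
      have "{x, y} \<in> edges A \<union> edges B"
        using S that by (simp add: complete_subgraph_def graph_union_def)
      then show ?thesis
        using sub that cA simple_graph_edge[OF sB] unfolding complete_subgraph_def by blast
    qed
    then have "complete_subgraph A S" using sub by (simp add: complete_subgraph_def)
    from card_le_clique_number[OF sA this] S(2) show ?thesis by simp
  next
    assume sub: "S \<subseteq> verts B"
    have "{x, y} \<in> edges B" if "x \<in> S" "y \<in> S" "x \<noteq> y" for x y
    proof -
      have "{x, y} \<in> edges A \<union> edges B"
        using S that by (simp add: complete_subgraph_def graph_union_def)
      then show ?thesis
        using sub that cB simple_graph_edge[OF sA] unfolding complete_subgraph_def by blast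
    qed
    then have "complete_subgraph B S" using sub by (simp add: complete_subgraph_def)
    from card_le_clique_number[OF sB this] S(2) show ?thesis by simp
  qed
qed

lemma clique_number_complete:
  assumes "simple_graph G" and "complete_subgraph G (verts G)"
  shows "clique_number G = card (verts G)"
proof (rule antisym)
  obtain S where S: "complete_subgraph G S" "card S = clique_number G"
    using assms(1) by (rule clique_number_attained)
  then show "clique_number G \<le> card (verts G)"
    using assms(1) unfolding complete_subgraph_def simple_graph_def by (metis card_mono)
qed (use card_le_clique_number assms in blast)

text \<open>Makes the set in \<open>treewidth\<close> nonempty, so that its \<open>LEAST\<close> is
  attained.\<close>

lemma chordal_completion_complete:
  assumes "simple_graph G"
  shows "chordal_completion G (complete_graph_on (verts G))"
proof -
  have "chordal (complete_graph_on (verts G))"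
    by (rule chordal_complete)
      (auto simp: complete_subgraph_def complete_graph_on_edge_iff, auto simp: complete_graph_on_def)
  moreover have "edges G \<subseteq> edges (complete_graph_on (verts G))"
    using assms unfolding complete_graph_on_def simple_graph_def by simp blast
  ultimately show ?thesis
    using assms simple_complete_graph_on[of "verts G"]
    by (simp add: chordal_completion_def complete_graph_on_def simple_graph_def)
qed

lemma treewidth_attained:
  assumes "simple_graph G"
  obtains G' where "chordal_completion G G'" "treewidth G = clique_number G'"
  using LeastI_ex[of "\<lambda>k. \<exists>G'. chordal_completion G G' \<and> k = clique_number G'"]
    chordal_completion_complete[OF assms] that
  unfolding treewidth_def by blast

lemma treewidth_le: "chordal_completion G G' \<Longrightarrow> treewidth G \<le> clique_number G'"
  unfolding treewidth_def by (rule Least_le) blast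

lemma chordal_completion_embedding:
  "chordal_completion G G' \<Longrightarrow> graph_embedding id G G'"
  by (auto simp: chordal_completion_def graph_embedding_def)

lemma treewidth_chordal:
  assumes "simple_graph G" and "chordal G"
  shows "treewidth G = clique_number G"
proof (rule antisym)
  show "treewidth G \<le> clique_number G"
    using assms by (intro treewidth_le) (simp add: chordal_completion_def)
  obtain G' where G': "chordal_completion G G'" "treewidth G = clique_number G'"
    using assms(1) by (rule treewidth_attained)
  then show "clique_number G \<le> treewidth G"
    using clique_number_mono[OF assms(1) _ chordal_completion_embedding]
    by (simp add: chordal_completion_def)
qed

lemma treewidth_complete:
  assumes "is_complete_graph n G"
  shows "treewidth G = n"
  using assms
  by (simp add: is_complete_graph_def treewidth_chordal chordal_complete clique_number_complete)

text \<open>A chordal completion of \<open>H\<close> is pulled back along \<open>f\<close>.\<close>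

lemma treewidth_mono:
  assumes sG: "simple_graph G" and sH: "simple_graph H" and emb: "graph_embedding f G H"
  shows "treewidth G \<le> treewidth H"
proof -
  obtain H' where H': "chordal_completion H H'" "treewidth H = clique_number H'"
    using sH by (rule treewidth_attained)
  then have sH': "simple_graph H'" and chH': "chordal H'" and vH': "verts H' = verts H"
    and eH': "edges H \<subseteq> edges H'"
    by (simp_all add: chordal_completion_def)
  have inj: "inj_on f (verts G)" and sub: "f ` verts G \<subseteq> verts H'"
    and fe: "\<And>u v. {u, v} \<in> edges G \<Longrightarrow> {f u, f v} \<in> edges H'"
    using emb eH' vH' by (auto simp: graph_embedding_def)
  \<comment> \<open>All pairs with adjacent images become edges. This makes \<open>f\<close> a full
    embedding into \<open>H'\<close>, through which both chordality and the clique bound transfer;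
    loops cannot arise because \<open>H'\<close> has none.\<close>
  define G' where "G' = \<lparr>verts = verts G,
    edges = {{u, v} | u v. u \<in> verts G \<and> v \<in> verts G \<and> {f u, f v} \<in> edges H'}\<rparr>"
  have edge_iff: "{u, v} \<in> edges G' \<longleftrightarrow> u \<in> verts G \<and> v \<in> verts G \<and> {f u, f v} \<in> edges H'" for u v
    by (auto simp: G'_def doubleton_eq_iff insert_commute)
  have sG': "simple_graph G'"
    unfolding simple_graph_def
  proof (intro conjI ballI)
    fix e assume "e \<in> edges G'"
    then obtain u v where uv: "u \<in> verts G" "v \<in> verts G" "{f u, f v} \<in> edges H'" "e = {u, v}"
      by (auto simp: G'_def)
    moreover then have "u \<noteq> v" using simple_graph_edge(3)[OF sH'] by blast
    ultimately show "\<exists>u\<in>verts G'. \<exists>v\<in>verts G'. u \<noteq> v \<and> e = {u, v}"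
      unfolding G'_def by auto
  qed (use sG in \<open>simp add: G'_def simple_graph_def\<close>)
  have "edges G \<subseteq> edges G'"
  proof
    fix e assume e: "e \<in> edges G"
    then obtain u v where "u \<in> verts G" "v \<in> verts G" "e = {u, v}"
      using sG by (blast elim: simple_graph_edge_cases)
    with e fe edge_iff show "e \<in> edges G'" by simp
  qed
  moreover have "chordal G'"
    by (rule chordal_full_embedding[of f, OF _ _ _ chH']) (use inj sub in \<open>simp_all add: edge_iff\<close>, simp_all add: G'_def)
  ultimately have "chordal_completion G G'"
    using sG' by (simp add: chordal_completion_def) (simp add: G'_def)
  then have "treewidth G \<le> clique_number G'" by (rule treewidth_le)
  also have "graph_embedding f G' H'"
    using inj sub unfolding graph_embedding_def edge_iff by (simp add: G'_def)
  then have "clique_number G' \<le> clique_number H'" by (rule clique_number_mono[OF sG' sH'])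
  finally show ?thesis using H' by simp
qed

text \<open>Completions change no vertex set and lose no edge, so optimal completions of the two
  sides still meet in the same clique, and their union is a completion of the union.\<close>

lemma treewidth_graph_union:
  assumes sA: "simple_graph A" and sB: "simple_graph B"
    and cA: "complete_subgraph A (verts A \<inter> verts B)"
    and cB: "complete_subgraph B (verts A \<inter> verts B)"
  shows "treewidth (graph_union A B) \<le> max (treewidth A) (treewidth B)"
proof -
  obtain A' where A': "chordal_completion A A'" "treewidth A = clique_number A'"
    using sA by (rule treewidth_attained)
  obtain B' where B': "chordal_completion B B'" "treewidth B = clique_number B'"
    using sB by (rule treewidth_attained)
  have sA': "simple_graph A'" "chordal A'" "verts A' = verts A" "edges A \<subseteq> edges A'"
    and sB': "simple_graph B'" "chordal B'" "verts B' = verts B" "edges B \<subseteq> edges B'"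
    using A' B' by (simp_all add: chordal_completion_def)
  have cA': "complete_subgraph A' (verts A' \<inter> verts B')"
    and cB': "complete_subgraph B' (verts A' \<inter> verts B')"
    using cA cB sA' sB' unfolding complete_subgraph_def by auto
  have "chordal (graph_union A' B')"
    using chordal_graph_union sA' sB' cA' cB' by blast
  then have "chordal_completion (graph_union A B) (graph_union A' B')"
    using sA' sB' simple_graph_union[of A' B']
    unfolding chordal_completion_def by (auto simp: graph_union_def)
  then have "treewidth (graph_union A B) \<le> clique_number (graph_union A' B')"
    by (rule treewidth_le)
  also have "\<dots> \<le> max (clique_number A') (clique_number B')"
    using clique_number_graph_union sA' sB' cA' cB' by blast
  finally show ?thesis using A' B' by simp
qed

section \<open>Pushouts of graph monomorphisms\<close>

lemma Grph_simps [simp]: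
  "obj Grph = {G. simple_graph G}"
  "src Grph = dom_graph"
  "tgt Grph = cod_graph"
  "dom_graph (cmp Grph g f) = dom_graph f"
  "cod_graph (cmp Grph g f) = cod_graph g"
  "vmap (cmp Grph g f) = compose (verts (dom_graph f)) (vmap g) (vmap f)"
  by (simp_all add: Grph_def)

lemma hom_Grph_iff: "f \<in> hom Grph X Y \<longleftrightarrow> graph_hom f \<and> dom_graph f = X \<and> cod_graph f = Y"
  by (auto simp: hom_def Grph_def)

lemma monomorphism_graph_embedding:
  assumes "monomorphism Grph f"
  shows "simple_graph (dom_graph f)" "simple_graph (cod_graph f)"
    "graph_embedding (vmap f) (dom_graph f) (cod_graph f)"
  using assms unfolding monomorphism_Grph_iff graph_hom_def graph_embedding_def by auto

text \<open>The restriction supplies the value \<open>undefined\<close> off the vertex set that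
  \<open>graph_hom\<close> demands.\<close>

definition vertex_arrow :: "'v graph \<Rightarrow> ('v \<Rightarrow> 'v) \<Rightarrow> 'v graph \<Rightarrow> 'v graph_arrow" where
  "vertex_arrow G f H = \<lparr>dom_graph = G, vmap = restrict f (verts G), cod_graph = H\<rparr>"

lemma vertex_arrow_simps [simp]:
  "dom_graph (vertex_arrow G f H) = G"
  "cod_graph (vertex_arrow G f H) = H"
  "vmap (vertex_arrow G f H) = restrict f (verts G)"
  by (simp_all add: vertex_arrow_def)

lemma monomorphism_vertex_arrow:
  assumes sG: "simple_graph G" and sH: "simple_graph H" and emb: "graph_embedding f G H"
  shows "monomorphism Grph (vertex_arrow G f H)"
  unfolding monomorphism_Grph_iff graph_hom_def
proof (intro conjI allI impI)
  fix u v assume "{u, v} \<in> edges (dom_graph (vertex_arrow G f H))"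
  then have e: "{u, v} \<in> edges G" by simp
  then show "{vmap (vertex_arrow G f H) u, vmap (vertex_arrow G f H) v}
      \<in> edges (cod_graph (vertex_arrow G f H))"
    using emb simple_graph_edge[OF sG e] by (simp add: graph_embedding_def)
qed (use assms in \<open>auto simp: graph_embedding_def image_subset_iff inj_on_def\<close>)

lemma graph_hom_monomorphism: "monomorphism Grph f \<Longrightarrow> graph_hom f"
  by (simp add: monomorphism_Grph_iff)

lemma vmap_cmp_eqD:
  assumes "cmp Grph a g = cmp Grph b h" and "x \<in> verts (dom_graph g)" and "dom_graph h = dom_graph g"
  shows "vmap a (vmap g x) = vmap b (vmap h x)"
  using arg_cong[OF assms(1), of "\<lambda>f. vmap f x"] assms(2,3) by (simp add: compose_def)

text \<open>The concrete picture of a pushout along monomorphisms, without any test object. The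
  treewidth of a chosen apex and the injectivity of maps out of it are read off from this.\<close>

definition glued_cocone ::
  "'v graph_arrow \<Rightarrow> 'v graph_arrow \<Rightarrow> ('v graph, 'v graph_arrow) cocone \<Rightarrow> bool" where
  "glued_cocone g h c \<longleftrightarrow>
     left_leg c \<in> hom Grph (cod_graph g) (apex c) \<and> monomorphism Grph (left_leg c) \<and>
     right_leg c \<in> hom Grph (cod_graph h) (apex c) \<and> monomorphism Grph (right_leg c) \<and>
     cmp Grph (left_leg c) g = cmp Grph (right_leg c) h \<and>
     apex c = graph_union (graph_image (vmap (left_leg c)) (cod_graph g))
       (graph_image (vmap (right_leg c)) (cod_graph h)) \<and>
     (\<forall>x \<in> verts (cod_graph g). \<forall>y \<in> verts (cod_graph h).
       vmap (left_leg c) x = vmap (right_leg c) y \<longrightarrow>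
       (\<exists>z \<in> verts (dom_graph g). x = vmap g z \<and> y = vmap h z))"

text \<open>Relocates \<open>H\<close> inside the vertex type so that it overlaps \<open>G\<close>
  in the span only; infinitely many vertices outside \<open>G\<close> leave room for the rest of
  \<open>H\<close>.\<close>

lemma injective_extension:
  fixes g :: "'a \<Rightarrow> 'c::infinite" and h :: "'a \<Rightarrow> 'b"
  assumes finG: "finite G" and finH: "finite H" and g: "inj_on g X" "g ` X \<subseteq> G"
    and h: "inj_on h X"
  obtains k where "inj_on k H" "\<And>z. z \<in> X \<Longrightarrow> k (h z) = g z"
    "\<And>w. w \<in> H \<Longrightarrow> w \<notin> h ` X \<Longrightarrow> k w \<notin> G"
proof -
  have "infinite (UNIV - G)" using finG infinite_UNIV by (rule Diff_infinite_finite)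
  then obtain B where B: "finite B" "card B = card H" "B \<subseteq> UNIV - G"
    using infinite_arbitrarily_large by metis
  then obtain \<phi> where \<phi>: "bij_betw \<phi> H B" using finH by (metis finite_same_card_bij)
  then have \<phi>G: "\<phi> w \<notin> G" if "w \<in> H" for w using that B by (auto simp: bij_betw_def)
  define k where "k w = (if w \<in> h ` X then g (inv_into X h w) else \<phi> w)" for w
  have k_h: "k (h z) = g z" if "z \<in> X" for z using that h by (simp add: k_def)
  have k_new: "k w \<notin> G" if "w \<in> H" "w \<notin> h ` X" for w using that \<phi>G by (simp add: k_def)
  have k_old: "k w \<in> G" if "w \<in> h ` X" for w using that k_h g(2) by auto
  have "inj_on k H"
  proof (rule inj_onI)
    fix v w assume v: "v \<in> H" and w: "w \<in> H" and eq: "k v = k w"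
    show "v = w"
    proof (cases "v \<in> h ` X")
      case True
      then have "w \<in> h ` X" using eq k_new[OF w] k_old[OF True] by auto
      with True eq k_h g(1) show ?thesis by (auto dest: inj_onD)
    next
      case False
      then have "w \<notin> h ` X" using eq k_new[OF v] k_old[of w] by auto
      with False eq v w \<phi> show ?thesis by (simp add: k_def bij_betw_def inj_on_def)
    qed
  qed
  with that k_h k_new show ?thesis by blast
qed

text \<open>Testing the universal property against a large complete graph shows that the legs are
  injective and meet only in the span; testing it against the union of the images of the legs
  shows that this union is the whole apex.\<close>

lemma pushout_glued_cocone:
  fixes g h :: "'v::infinite graph_arrow"
  assumes g: "monomorphism Grph g" and h: "monomorphism Grph h"
    and dom: "dom_graph h = dom_graph g" and po: "is_pushout Grph g h c"
  shows "glued_cocone g h c"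
proof -
  define G H X Q l r where defs: "G = cod_graph g" "H = cod_graph h" "X = dom_graph g"
    "Q = apex c" "l = left_leg c" "r = right_leg c"
  have sG: "simple_graph G" and sH: "simple_graph H"
    using monomorphism_graph_embedding g h by (auto simp: defs)
  have gX: "inj_on (vmap g) (verts X)" "vmap g ` verts X \<subseteq> verts G"
    and hX: "inj_on (vmap h) (verts X)" "vmap h ` verts X \<subseteq> verts H"
    using monomorphism_graph_embedding(3)[OF g] monomorphism_graph_embedding(3)[OF h] dom
    by (auto simp: defs graph_embedding_def)
  have l: "l \<in> hom Grph G Q" and r: "r \<in> hom Grph H Q" and comm: "cmp Grph l g = cmp Grph r h"
    and univ: "\<And>T a b. a \<in> hom Grph G T \<Longrightarrow> b \<in> hom Grph H T \<Longrightarrow> cmp Grph a g = cmp Grph b h \<Longrightarrow>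
       \<exists>!u. u \<in> hom Grph Q T \<and> cmp Grph u l = a \<and> cmp Grph u r = b"
    using po by (simp_all add: is_pushout_def defs)
  have sQ: "simple_graph Q" using l by (auto simp: hom_Grph_iff graph_hom_def)

  obtain k where k: "inj_on k (verts H)" "\<And>z. z \<in> verts X \<Longrightarrow> k (vmap h z) = vmap g z"
    and k_new: "\<And>w. w \<in> verts H \<Longrightarrow> w \<notin> vmap h ` verts X \<Longrightarrow> k w \<notin> verts G"
    using injective_extension[of "verts G" "verts H" "vmap g" "verts X" "vmap h"] sG sH gX hX
    unfolding simple_graph_def by metis
  \<comment> \<open>A complete target accepts every injective map as a homomorphism. In it
    \<open>G\<close> sits by inclusion and \<open>H\<close> by \<open>k\<close>, and the two agree
    on the span.\<close>
  define T where "T = complete_graph_on (verts G \<union> k ` verts H)"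
  have T: "simple_graph T" "complete_subgraph T (verts T)" "verts T = verts G \<union> k ` verts H"
    using sG sH
    by (auto simp: T_def simple_graph_def complete_graph_on_def complete_subgraph_def)
  define a where "a = vertex_arrow G (\<lambda>x. x) T"
  define b where "b = vertex_arrow H k T"
  have "graph_embedding (\<lambda>x. x) G T" "graph_embedding k H T"
    by (rule graph_embedding_complete; use sG sH k T in auto)+
  then have ab: "a \<in> hom Grph G T" "b \<in> hom Grph H T"
    using monomorphism_vertex_arrow sG sH T unfolding a_def b_def hom_Grph_iff
    by (auto intro: graph_hom_monomorphism)
  have "cmp Grph a g = cmp Grph b h"
  proof (rule graph_arrow_eqI)
    show "graph_hom (cmp Grph a g)" "graph_hom (cmp Grph b h)"
      using category.cmp_hom[OF category_Grph, of g X G a T]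
        category.cmp_hom[OF category_Grph, of h X H b T] ab g h dom
      by (auto simp: hom_Grph_iff defs graph_hom_monomorphism)
    fix v assume "v \<in> verts (dom_graph (cmp Grph a g))"
    then have "v \<in> verts X" by (simp add: defs)
    then show "vmap (cmp Grph a g) v = vmap (cmp Grph b h) v"
      using gX hX k dom unfolding defs by (auto simp: a_def b_def compose_def defs)
  qed (simp_all add: a_def b_def dom)
  then obtain u where u: "cmp Grph u l = a" "cmp Grph u r = b"
    using univ[OF ab] by blast
  have dl: "dom_graph l = G" "cod_graph l = Q" and dr: "dom_graph r = H" "cod_graph r = Q"
    using l r by (simp_all add: hom_Grph_iff)
  have ul: "vmap u (vmap l x) = x" if "x \<in> verts G" for x
    using arg_cong[OF u(1), of "\<lambda>f. vmap f x"] that dl by (simp add: a_def compose_def)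
  have ur: "vmap u (vmap r y) = k y" if "y \<in> verts H" for y
    using arg_cong[OF u(2), of "\<lambda>f. vmap f y"] that dr by (simp add: b_def compose_def)
  \<comment> \<open>The mediating map \<open>u\<close> is a left inverse of \<open>l\<close>, and
    composed with \<open>r\<close> it is the injective \<open>k\<close>.\<close>
  have injl: "inj_on (vmap l) (verts G)" using ul by (rule inj_on_inverseI)
  have injr: "inj_on (vmap r) (verts H)"
    using ur k(1) by (metis inj_on_def)
  \<comment> \<open>Applying \<open>u\<close> to a coincidence of the legs gives
    \<open>x = k y\<close>; a vertex \<open>y\<close> outside the span would be sent outside
    \<open>G\<close>.\<close>
  have meet: "\<exists>z \<in> verts X. x = vmap g z \<and> y = vmap h z"
    if "x \<in> verts G" "y \<in> verts H" "vmap l x = vmap r y" for x y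
  proof -
    have "x = k y" using ul ur that by metis
    then have "y \<in> vmap h ` verts X" using k_new that by blast
    with \<open>x = k y\<close> k(2) show ?thesis by auto
  qed

  define Q' where "Q' = graph_union (graph_image (vmap l) G) (graph_image (vmap r) H)"
  have sQ': "simple_graph Q'"
    unfolding Q'_def by (intro simple_graph_union simple_graph_image sG sH injl injr)
  have lv: "vmap l ` verts G \<subseteq> verts Q" and rv: "vmap r ` verts H \<subseteq> verts Q"
    and le: "\<And>x y. {x, y} \<in> edges G \<Longrightarrow> {vmap l x, vmap l y} \<in> edges Q"
    and re: "\<And>x y. {x, y} \<in> edges H \<Longrightarrow> {vmap r x, vmap r y} \<in> edges Q"
    using l r by (auto simp: hom_Grph_iff graph_hom_def)
  have embl: "graph_embedding (vmap l) G Q'" and embr: "graph_embedding (vmap r) H Q'"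
    using graph_embedding_image[OF injl] graph_embedding_image[OF injr]
    by (auto simp: graph_embedding_def Q'_def graph_union_def)
  have vQ': "verts Q' \<subseteq> verts Q" using lv rv by (simp add: Q'_def graph_union_def graph_image_def)
  have eQ': "edges Q' \<subseteq> edges Q"
  proof
    fix e assume "e \<in> edges Q'"
    then consider e' where "e' \<in> edges G" "e = vmap l ` e'" | e' where "e' \<in> edges H" "e = vmap r ` e'"
      by (auto simp: Q'_def graph_union_def graph_image_def)
    then show "e \<in> edges Q"
    proof cases
      case 1
      then obtain x y where "e' = {x, y}" using simple_graph_edge_cases[OF sG] by metis
      with 1 le show ?thesis by simp
    next
      case 2
      then obtain x y where "e' = {x, y}" using simple_graph_edge_cases[OF sH] by metis
      with 2 re show ?thesis by simp
    qed
  qed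
  \<comment> \<open>The same legs with their codomain cut down to \<open>Q'\<close>, and the
    inclusion of \<open>Q'\<close> into the apex. The map \<open>w\<close> induced by the cut-down
    legs goes the other way.\<close>
  define l' r' i where "l' = vertex_arrow G (vmap l) Q'" and "r' = vertex_arrow H (vmap r) Q'"
    and "i = vertex_arrow Q' (\<lambda>x. x) Q"
  note arrow_defs = l'_def r'_def i_def
  have "graph_embedding (\<lambda>x. x) Q' Q" using vQ' eQ' by (auto simp: graph_embedding_def)
  then have l': "l' \<in> hom Grph G Q'" and r': "r' \<in> hom Grph H Q'" and i: "i \<in> hom Grph Q' Q"
    using monomorphism_vertex_arrow embl embr sG sH sQ sQ' unfolding arrow_defs hom_Grph_iff
    by (auto intro: graph_hom_monomorphism)
  have gh: "g \<in> hom Grph X G" "h \<in> hom Grph X H"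
    using g h dom by (simp_all add: hom_Grph_iff defs graph_hom_monomorphism)
  have il: "cmp Grph i l' = l"
  proof (rule graph_arrow_eqI)
    show "graph_hom (cmp Grph i l')" "graph_hom l"
      using category.cmp_hom[OF category_Grph l' i] l by (simp_all add: hom_Grph_iff)
    fix v assume "v \<in> verts (dom_graph (cmp Grph i l'))"
    then have "v \<in> verts G" by (simp add: l'_def)
    moreover then have "vmap l v \<in> verts Q'" using embl by (auto simp: graph_embedding_def)
    ultimately show "vmap (cmp Grph i l') v = vmap l v" by (simp add: l'_def i_def compose_def)
  qed (simp_all add: arrow_defs dl)
  have ir: "cmp Grph i r' = r"
  proof (rule graph_arrow_eqI)
    show "graph_hom (cmp Grph i r')" "graph_hom r"
      using category.cmp_hom[OF category_Grph r' i] r by (simp_all add: hom_Grph_iff)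
    fix v assume "v \<in> verts (dom_graph (cmp Grph i r'))"
    then have "v \<in> verts H" by (simp add: r'_def)
    moreover then have "vmap r v \<in> verts Q'" using embr by (auto simp: graph_embedding_def)
    ultimately show "vmap (cmp Grph i r') v = vmap r v" by (simp add: r'_def i_def compose_def)
  qed (simp_all add: arrow_defs dr)
  have "cmp Grph l' g = cmp Grph r' h"
  proof (rule graph_arrow_eqI)
    show "graph_hom (cmp Grph l' g)" "graph_hom (cmp Grph r' h)"
      using category.cmp_hom[OF category_Grph gh(1) l'] category.cmp_hom[OF category_Grph gh(2) r']
      by (simp_all add: hom_Grph_iff)
    fix v assume "v \<in> verts (dom_graph (cmp Grph l' g))"
    then have v: "v \<in> verts X" by (simp add: defs)
    then have "vmap l (vmap g v) = vmap r (vmap h v)"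
      using vmap_cmp_eqD[OF comm] dom by (simp add: defs)
    moreover have "vmap g v \<in> verts G" "vmap h v \<in> verts H" using v gX hX by auto
    ultimately show "vmap (cmp Grph l' g) v = vmap (cmp Grph r' h) v"
      using v dom by (simp add: compose_def l'_def r'_def defs)
  qed (simp_all add: arrow_defs dom)
  from univ[OF l' r' this] obtain w where
    w: "w \<in> hom Grph Q Q'" "cmp Grph w l = l'" "cmp Grph w r = r'" by blast
  have iw: "cmp Grph i w \<in> hom Grph Q Q" using category.cmp_hom[OF category_Grph w(1) i] .
  moreover have "cmp Grph (cmp Grph i w) l = l" "cmp Grph (cmp Grph i w) r = r"
    using category.cmp_assoc[OF category_Grph l w(1) i] category.cmp_assoc[OF category_Grph r w(1) i]
      w il ir by simp_all
  moreover have "ident Grph Q \<in> hom Grph Q Q"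
    using category.ident_hom[OF category_Grph] sQ by simp
  moreover have "cmp Grph (ident Grph Q) l = l" "cmp Grph (ident Grph Q) r = r"
    using category.cmp_ident_left[OF category_Grph l] category.cmp_ident_left[OF category_Grph r] .
  \<comment> \<open>Both arrows fix the legs, so uniqueness identifies them. As \<open>i\<close>
    does not move vertices, \<open>w\<close> is the identity on vertices, and being a homomorphism
    into \<open>Q'\<close> it puts all of \<open>Q\<close> inside \<open>Q'\<close>.\<close>
  ultimately have iw_id: "cmp Grph i w = ident Grph Q"
    using univ[OF l r comm] by blast
  have wv: "vmap w q \<in> verts Q'" if "q \<in> verts Q" for q
    using w(1) that by (auto simp: hom_Grph_iff graph_hom_def)
  have w_id: "vmap w q = q" if q: "q \<in> verts Q" for q
  proof -
    have "vmap (cmp Grph i w) q = vmap (ident Grph Q) q" using iw_id by simp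
    then show ?thesis
      using q w(1) wv[OF q] by (simp add: hom_Grph_iff compose_def i_def) (simp add: Grph_def)
  qed
  have "verts Q \<subseteq> verts Q'" using wv w_id by fastforce
  moreover have "edges Q \<subseteq> edges Q'"
  proof
    fix e assume e: "e \<in> edges Q"
    then obtain p q where pq: "p \<in> verts Q" "q \<in> verts Q" "e = {p, q}"
      using simple_graph_edge_cases[OF sQ] by metis
    with e w(1) have "{vmap w p, vmap w q} \<in> edges Q'"
      by (auto simp: hom_Grph_iff graph_hom_def)
    with pq w_id show "e \<in> edges Q'" by simp
  qed
  ultimately have "Q = Q'" using vQ' eQ' by (intro graph.equality) auto
  moreover have "monomorphism Grph l" "monomorphism Grph r"
    using l r injl injr by (simp_all add: monomorphism_Grph_iff hom_Grph_iff)
  ultimately show ?thesis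
    using l r comm meet unfolding glued_cocone_def Q'_def defs by blast
qed

text \<open>Every vertex of the apex comes from one of the legs. Each leg alone is handled by
  injectivity of \<open>\<alpha>\<close> or \<open>\<beta>\<close>; a clash between the two sides
  must, by the meeting condition, come from the span, where the legs agree anyway. It is applied to
  the mediating map of SC2 and to the comparison of an apex with a graph split along a
  clique.\<close>

lemma glued_cocone_inj_on:
  assumes c: "glued_cocone g h c"
    and \<alpha>: "inj_on \<alpha> (verts (cod_graph g))" and \<beta>: "inj_on \<beta> (verts (cod_graph h))"
    and meet: "\<And>x y. \<lbrakk>x \<in> verts (cod_graph g); y \<in> verts (cod_graph h); \<alpha> x = \<beta> y\<rbrakk>
      \<Longrightarrow> \<exists>z \<in> verts (dom_graph g). x = vmap g z \<and> y = vmap h z"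
    and dom: "dom_graph h = dom_graph g"
    and u: "\<And>x. x \<in> verts (cod_graph g) \<Longrightarrow> u (vmap (left_leg c) x) = \<alpha> x"
      "\<And>y. y \<in> verts (cod_graph h) \<Longrightarrow> u (vmap (right_leg c) y) = \<beta> y"
  shows "inj_on u (verts (apex c))"
proof -
  let ?l = "vmap (left_leg c)" and ?r = "vmap (right_leg c)"
  have cross: "?l x = ?r y"
    if xy: "x \<in> verts (cod_graph g)" "y \<in> verts (cod_graph h)" "\<alpha> x = \<beta> y" for x y
  proof -
    obtain z where "z \<in> verts (dom_graph g)" "x = vmap g z" "y = vmap h z"
      using meet[OF xy] by blast
    then show ?thesis using c vmap_cmp_eqD dom unfolding glued_cocone_def by metis
  qed
  have cases: "(\<exists>x \<in> verts (cod_graph g). p = ?l x) \<or> (\<exists>y \<in> verts (cod_graph h). p = ?r y)"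
    if "p \<in> verts (apex c)" for p
    using c that unfolding glued_cocone_def by (auto simp: graph_union_def graph_image_def)
  show ?thesis
  proof (rule inj_onI)
    fix p q assume "p \<in> verts (apex c)" "q \<in> verts (apex c)" and eq: "u p = u q"
    from cases[OF this(1)] cases[OF this(2)] eq show "p = q"
      using u cross \<alpha> \<beta> by (elim disjE bexE) (metis inj_onD)+
  qed
qed

section \<open>The spined category of graphs and monomorphisms\<close>

lemma Grph_m_simps [simp]:
  "obj (Grph_m K P) = {G. simple_graph G}"
  "arr (Grph_m K P) = {f. monomorphism Grph f}"
  "src (Grph_m K P) = dom_graph"
  "tgt (Grph_m K P) = cod_graph"
  "ident (Grph_m K P) = ident Grph"
  "cmp (Grph_m K P) = cmp Grph"
  "spine (Grph_m K P) = K"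
  "proxy (Grph_m K P) = P"
  by (simp_all add: Grph_m_def)

lemma hom_Grph_m_iff:
  "f \<in> hom (Grph_m K P) G H \<longleftrightarrow> monomorphism Grph f \<and> dom_graph f = G \<and> cod_graph f = H"
  by (simp add: hom_def)

lemma hom_Grph_m_Grph: "f \<in> hom (Grph_m K P) G H \<Longrightarrow> f \<in> hom Grph G H"
  by (simp add: hom_Grph_m_iff hom_Grph_iff graph_hom_monomorphism)

lemma graph_embedding_hom:
  assumes "f \<in> hom (Grph_m K P) G H"
  shows "simple_graph G" "simple_graph H" "graph_embedding (vmap f) G H"
  using assms monomorphism_graph_embedding by (auto simp: hom_Grph_m_iff)

lemma hom_graph_embedding:
  assumes "simple_graph G" and "simple_graph H" and "graph_embedding f G H"
  shows "vertex_arrow G f H \<in> hom (Grph_m K P) G H"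
  using monomorphism_vertex_arrow[OF assms] by (simp add: hom_Grph_m_iff)

lemma monomorphism_cmp:
  assumes f: "f \<in> hom (Grph_m K P) G H" and g: "g \<in> hom (Grph_m K P) H Q"
  shows "cmp Grph g f \<in> hom (Grph_m K P) G Q"
proof -
  have "cmp Grph g f \<in> hom Grph G Q"
    using category.cmp_hom[OF category_Grph] hom_Grph_m_Grph f g by blast
  moreover have "inj_on (vmap g \<circ> vmap f) (verts G)"
    using graph_embedding_comp[OF graph_embedding_hom(3)[OF f] graph_embedding_hom(3)[OF g]]
    by (simp add: graph_embedding_def)
  then have "inj_on (vmap (cmp Grph g f)) (verts G)"
    using f by (auto simp: hom_Grph_m_iff inj_on_def compose_def)
  ultimately show ?thesis by (simp add: hom_Grph_m_iff hom_Grph_iff monomorphism_Grph_iff)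
qed

lemma category_Grph_m: "category (Grph_m K P)"
proof unfold_locales
  fix f X Y g Z assume "f \<in> hom (Grph_m K P) X Y" "g \<in> hom (Grph_m K P) Y Z"
  then show "cmp (Grph_m K P) g f \<in> hom (Grph_m K P) X Z" by (simp add: monomorphism_cmp)
next
  fix X assume "X \<in> obj (Grph_m K P)"
  then have "simple_graph X" by simp
  then have "ident Grph X \<in> hom Grph X X" using category.ident_hom[OF category_Grph] by simp
  then show "ident (Grph_m K P) X \<in> hom (Grph_m K P) X X"
    by (simp add: hom_Grph_iff hom_Grph_m_iff monomorphism_Grph_iff)
      (simp add: Grph_def)
next
  fix f W X g Y h Z
  assume "f \<in> hom (Grph_m K P) W X" "g \<in> hom (Grph_m K P) X Y" "h \<in> hom (Grph_m K P) Y Z"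
  from this[THEN hom_Grph_m_Grph]
  show "cmp (Grph_m K P) h (cmp (Grph_m K P) g f) = cmp (Grph_m K P) (cmp (Grph_m K P) h g) f"
    using category.cmp_assoc[OF category_Grph] by simp
next
  fix f X Y assume "f \<in> hom (Grph_m K P) X Y"
  from this[THEN hom_Grph_m_Grph]
  show "cmp (Grph_m K P) f (ident (Grph_m K P) X) = f" "cmp (Grph_m K P) (ident (Grph_m K P) Y) f = f"
    using category.cmp_ident_left[OF category_Grph] category.cmp_ident_right[OF category_Grph]
    by simp_all
qed (auto dest: monomorphism_graph_embedding)

lemma complete_graph_embedding:
  assumes G: "simple_graph G" "card (verts G) = n" and K: "is_complete_graph n K"
  shows "\<exists>f. graph_embedding f G K"
proof -
  obtain f where "bij_betw f (verts G) (verts K)"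
    using G K by (metis finite_same_card_bij is_complete_graph_def simple_graph_def)
  then have "graph_embedding f G K"
    using G K by (intro graph_embedding_complete) (auto simp: bij_betw_def is_complete_graph_def)
  then show ?thesis by blast
qed

definition treewidth_functor :: "('v graph, 'v graph_arrow, nat, nat \<times> nat) functor_data" where
  "treewidth_functor =
     \<lparr>fobj = treewidth, farr = (\<lambda>f. (treewidth (dom_graph f), treewidth (cod_graph f)))\<rparr>"

locale graph_choices =
  fixes K :: "nat \<Rightarrow> 'v::infinite graph"
    and P :: "'v graph_arrow \<Rightarrow> 'v graph_arrow \<Rightarrow> ('v graph, 'v graph_arrow) cocone"
  assumes K: "complete_graph_choice K"
    and P: "pushout_choice K P"
begin

lemma is_complete_K: "is_complete_graph n (K n)"
  using K by (simp add: complete_graph_choice_def)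

lemma simple_K: "simple_graph (K n)"
  using is_complete_K by (auto simp: is_complete_graph_def)

lemma pushout_P:
  assumes "g \<in> hom (Grph_m K P) (K n) G" and "h \<in> hom (Grph_m K P) (K n) H"
  shows "is_pushout Grph g h (P g h)"
  using assms P by (simp add: pushout_choice_def hom_Grph_m_iff)

lemma glued_P:
  assumes "g \<in> hom (Grph_m K P) (K n) G" and "h \<in> hom (Grph_m K P) (K n) H"
  shows "glued_cocone g h (P g h)"
  using pushout_glued_cocone[OF _ _ _ pushout_P[OF assms]] assms by (simp add: hom_Grph_m_iff)

lemma legs_P:
  assumes "g \<in> hom (Grph_m K P) (K n) G" and "h \<in> hom (Grph_m K P) (K n) H"
  shows "left_leg (P g h) \<in> hom (Grph_m K P) G (apex (P g h))"
    and "right_leg (P g h) \<in> hom (Grph_m K P) H (apex (P g h))"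
    and "cmp Grph (left_leg (P g h)) g = cmp Grph (right_leg (P g h)) h"
  using glued_P[OF assms] assms
  by (simp_all add: glued_cocone_def hom_Grph_iff hom_Grph_m_iff)

text \<open>The mediating map of SC2 exists and is unique among all homomorphisms; what remains is
  that it is injective. For SC1, a graph embeds into the complete graph with equally many
  vertices.\<close>

lemma spined_category_Grph_m: "spined_category (Grph_m K P)"
proof (intro spined_category.intro spined_category_axioms.intro category_Grph_m)
  show "spine (Grph_m K P) n \<in> obj (Grph_m K P)" for n
    using simple_K by simp
next
  fix g n G h H
  assume "g \<in> hom (Grph_m K P) (spine (Grph_m K P) n) G" "h \<in> hom (Grph_m K P) (spine (Grph_m K P) n) H"
  then show "left_leg (proxy (Grph_m K P) g h) \<in> hom (Grph_m K P) G (apex (proxy (Grph_m K P) g h)) \<and>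
      right_leg (proxy (Grph_m K P) g h) \<in> hom (Grph_m K P) H (apex (proxy (Grph_m K P) g h)) \<and>
      cmp (Grph_m K P) (left_leg (proxy (Grph_m K P) g h)) g =
      cmp (Grph_m K P) (right_leg (proxy (Grph_m K P) g h)) h"
    using legs_P by simp
next
  fix X assume "X \<in> obj (Grph_m K P)"
  then have X: "simple_graph X" by simp
  then obtain f where "graph_embedding f X (K (card (verts X)))"
    using complete_graph_embedding is_complete_K by blast
  then show "\<exists>n. hom (Grph_m K P) X (spine (Grph_m K P) n) \<noteq> {}"
    using hom_graph_embedding[OF X simple_K] by (metis Grph_m_simps(7) empty_iff)
next
  fix g n G h H g' G' h' H'
  assume "g \<in> hom (Grph_m K P) (spine (Grph_m K P) n) G"
    and "h \<in> hom (Grph_m K P) (spine (Grph_m K P) n) H"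
    and g': "g' \<in> hom (Grph_m K P) G G'" and h': "h' \<in> hom (Grph_m K P) H H'"
  then have g: "g \<in> hom (Grph_m K P) (K n) G" and h: "h \<in> hom (Grph_m K P) (K n) H" by simp_all
  let ?c = "P g h" and ?c' = "P (cmp Grph g' g) (cmp Grph h' h)"
  let ?a = "cmp Grph (left_leg ?c') g'" and ?b = "cmp Grph (right_leg ?c') h'"
  have gg: "cmp Grph g' g \<in> hom (Grph_m K P) (K n) G'" "cmp Grph h' h \<in> hom (Grph_m K P) (K n) H'"
    using monomorphism_cmp g h g' h' by blast+
  note l' = legs_P[OF gg]
  have a: "?a \<in> hom (Grph_m K P) G (apex ?c')" and b: "?b \<in> hom (Grph_m K P) H (apex ?c')"
    using monomorphism_cmp l' g' h' by blast+
  have ab: "cmp Grph ?a g = cmp Grph ?b h"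
    using l'(3) category.cmp_assoc[OF category_Grph] g g' h h' l'(1,2) hom_Grph_m_Grph by metis
  have po: "is_pushout Grph g h ?c" using g h by (rule pushout_P)
  have doms: "dom_graph g = K n" "dom_graph h = K n" "cod_graph g = G" "cod_graph h = H"
    "dom_graph g' = G" "cod_graph g' = G'" "dom_graph h' = H" "cod_graph h' = H'"
    using g h g' h' by (simp_all add: hom_Grph_m_iff)
  have "\<exists>!u. u \<in> hom Grph (apex ?c) (apex ?c') \<and>
      cmp Grph u (left_leg ?c) = ?a \<and> cmp Grph u (right_leg ?c) = ?b"
    using po hom_Grph_m_Grph[OF a] hom_Grph_m_Grph[OF b] ab
    unfolding is_pushout_def by (simp add: doms)
  then obtain u where u: "u \<in> hom Grph (apex ?c) (apex ?c')"
      "cmp Grph u (left_leg ?c) = ?a" "cmp Grph u (right_leg ?c) = ?b"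
    and uniq: "\<And>w. w \<in> hom Grph (apex ?c) (apex ?c') \<Longrightarrow> cmp Grph w (left_leg ?c) = ?a \<Longrightarrow>
      cmp Grph w (right_leg ?c) = ?b \<Longrightarrow> w = u" by blast
  have "inj_on (vmap u) (verts (apex ?c))"
  proof (rule glued_cocone_inj_on[OF glued_P[OF g h], of "vmap ?a" "vmap ?b"])
    show "inj_on (vmap ?a) (verts (cod_graph g))" "inj_on (vmap ?b) (verts (cod_graph h))"
      using graph_embedding_hom(3)[OF a] graph_embedding_hom(3)[OF b]
      by (simp_all only: doms graph_embedding_def)
    show "dom_graph h = dom_graph g" by (simp add: doms)
    have lr: "dom_graph (left_leg ?c) = G" "dom_graph (right_leg ?c) = H"
      using legs_P[OF g h] by (simp_all add: hom_Grph_m_iff)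
    show "vmap u (vmap (left_leg ?c) x) = vmap ?a x" if "x \<in> verts (cod_graph g)" for x
      using that arg_cong[OF u(2), of "\<lambda>f. vmap f x"] lr by (simp add: doms compose_def)
    show "vmap u (vmap (right_leg ?c) y) = vmap ?b y" if "y \<in> verts (cod_graph h)" for y
      using that arg_cong[OF u(3), of "\<lambda>f. vmap f y"] lr by (simp add: doms compose_def)
    fix x y assume "x \<in> verts (cod_graph g)" "y \<in> verts (cod_graph h)" and eq: "vmap ?a x = vmap ?b y"
    then have x: "x \<in> verts G" and y: "y \<in> verts H" by (simp_all add: doms)
    have emb: "graph_embedding (vmap g) (K n) G" "graph_embedding (vmap h) (K n) H"
      "graph_embedding (vmap g') G G'" "graph_embedding (vmap h') H H'"
      using graph_embedding_hom(3) g h g' h' by blast+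
    \<comment> \<open>A coincidence in the larger pushout comes from a vertex \<open>z\<close> of
      the spine object; cancelling the injective \<open>g'\<close> and \<open>h'\<close> moves it
      down to the smaller span.\<close>
    have "vmap (left_leg ?c') (vmap g' x) = vmap (right_leg ?c') (vmap h' y)"
      using eq x y doms by (simp add: compose_def)
    moreover have "vmap g' x \<in> verts G'" "vmap h' y \<in> verts H'"
      using x y emb by (auto simp: graph_embedding_def)
    ultimately obtain z where z: "z \<in> verts (K n)" "vmap g' x = vmap g' (vmap g z)"
      "vmap h' y = vmap h' (vmap h z)"
      using glued_P[OF gg] unfolding glued_cocone_def by (auto simp: doms compose_def)
    moreover have "vmap g z \<in> verts G" "vmap h z \<in> verts H"
      using z(1) emb by (auto simp: graph_embedding_def)
    ultimately have "x = vmap g z" "y = vmap h z"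
      using x y emb(3,4) by (auto simp: graph_embedding_def dest: inj_onD)
    with z(1) show "\<exists>z \<in> verts (dom_graph g). x = vmap g z \<and> y = vmap h z"
      by (auto simp: doms)
  qed
  with u(1) have "u \<in> hom (Grph_m K P) (apex ?c) (apex ?c')"
    by (simp add: hom_Grph_m_iff hom_Grph_iff monomorphism_Grph_iff)
  with u(2,3) uniq hom_Grph_m_Grph
  show "\<exists>!u. u \<in> hom (Grph_m K P) (apex (proxy (Grph_m K P) g h))
          (apex (proxy (Grph_m K P) (cmp (Grph_m K P) g' g) (cmp (Grph_m K P) h' h))) \<and>
        cmp (Grph_m K P) u (left_leg (proxy (Grph_m K P) g h)) =
        cmp (Grph_m K P) (left_leg (proxy (Grph_m K P) (cmp (Grph_m K P) g' g) (cmp (Grph_m K P) h' h))) g' \<and>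
        cmp (Grph_m K P) u (right_leg (proxy (Grph_m K P) g h)) =
        cmp (Grph_m K P) (right_leg (proxy (Grph_m K P) (cmp (Grph_m K P) g' g) (cmp (Grph_m K P) h' h))) h'"
    unfolding Grph_m_simps by blast
qed

section \<open>Treewidth as an S-functor\<close>

lemma treewidth_apex:
  assumes g: "g \<in> hom (Grph_m K P) (K n) G" and h: "h \<in> hom (Grph_m K P) (K n) H"
  shows "treewidth (apex (P g h)) = max (treewidth G) (treewidth H)"
proof (rule antisym)
  note sG = graph_embedding_hom(2)[OF g] and sH = graph_embedding_hom(2)[OF h]
  note l = graph_embedding_hom[OF legs_P(1)[OF g h]] and r = graph_embedding_hom[OF legs_P(2)[OF g h]]
  show "max (treewidth G) (treewidth H) \<le> treewidth (apex (P g h))"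
    using treewidth_mono[OF l] treewidth_mono[OF r] by simp
  have doms: "dom_graph g = K n" "dom_graph h = K n" "cod_graph g = G" "cod_graph h = H"
    using g h by (simp_all add: hom_Grph_m_iff)
  let ?l = "vmap (left_leg (P g h))" and ?r = "vmap (right_leg (P g h))"
  let ?A = "graph_image ?l G" and ?B = "graph_image ?r H"
  have injl: "inj_on ?l (verts G)" and injr: "inj_on ?r (verts H)"
    using l(3) r(3) by (simp_all add: graph_embedding_def)
  have sA: "simple_graph ?A" and sB: "simple_graph ?B"
    by (intro simple_graph_image sG sH injl injr)+
  have K: "complete_subgraph (K n) (verts (K n))"
    using is_complete_K by (simp add: is_complete_graph_def)
  have comm: "?l (vmap g z) = ?r (vmap h z)" if "z \<in> verts (K n)" for z
    using vmap_cmp_eqD[OF legs_P(3)[OF g h]] that doms by simp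
  have A: "complete_subgraph ?A ((?l \<circ> vmap g) ` verts (K n))"
    by (rule complete_subgraph_image[OF graph_embedding_comp[OF graph_embedding_hom(3)[OF g]
      graph_embedding_image[OF injl]] K])
  have B: "complete_subgraph ?B ((?r \<circ> vmap h) ` verts (K n))"
    by (rule complete_subgraph_image[OF graph_embedding_comp[OF graph_embedding_hom(3)[OF h]
      graph_embedding_image[OF injr]] K])
  have eq: "(?r \<circ> vmap h) ` verts (K n) = (?l \<circ> vmap g) ` verts (K n)"
    using comm by (intro image_cong) simp_all
  \<comment> \<open>The legs meet only in the image of \<open>K n\<close>, which is complete in both
    copies, so the overlap is a clique on each side.\<close>
  have sub: "verts ?A \<inter> verts ?B \<subseteq> (?l \<circ> vmap g) ` verts (K n)"
    using glued_P[OF g h] unfolding glued_cocone_def doms by (fastforce simp: graph_image_def)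
  have cA: "complete_subgraph ?A (verts ?A \<inter> verts ?B)"
    by (rule complete_subgraph_subset[OF A sub])
  have cB: "complete_subgraph ?B (verts ?A \<inter> verts ?B)"
    by (rule complete_subgraph_subset[OF B[unfolded eq] sub])
  have "apex (P g h) = graph_union ?A ?B"
    using glued_P[OF g h] unfolding glued_cocone_def doms by blast
  then have "treewidth (apex (P g h)) \<le> max (treewidth ?A) (treewidth ?B)"
    using treewidth_graph_union[OF sA sB cA cB] by simp
  \<comment> \<open>The inverse embeddings show that the copies inside the apex have no larger
    treewidth than the originals.\<close>
  also have "\<dots> \<le> max (treewidth G) (treewidth H)"
    using treewidth_mono[OF sA sG graph_embedding_inv_image[OF sG injl]]
      treewidth_mono[OF sB sH graph_embedding_inv_image[OF sH injr]]
    by (rule max.mono)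
  finally show "treewidth (apex (P g h)) \<le> max (treewidth G) (treewidth H)" .
qed

lemma treewidth_S_functor: "S_functor (Grph_m K P) treewidth_functor"
proof (intro spinal_functor.intro is_functor.intro is_functor_axioms.intro
    spinal_functor_axioms.intro spined_category_Grph_m Nat_cat_spined category_Grph_m
    spined_category.axioms(1)[OF Nat_cat_spined])
  show "fobj treewidth_functor (spine (Grph_m K P) n) = spine Nat_cat n" for n
    using treewidth_complete[OF is_complete_K] by (simp add: treewidth_functor_def Nat_cat_def)
next
  fix f X Y assume f: "f \<in> hom (Grph_m K P) X Y"
  then have "treewidth X \<le> treewidth Y"
    using treewidth_mono graph_embedding_hom by blast
  with f show "farr treewidth_functor f
      \<in> hom Nat_cat (fobj treewidth_functor X) (fobj treewidth_functor Y)"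
    by (auto simp: treewidth_functor_def hom_def Nat_cat_def)
next
  fix g n G h H
  assume "g \<in> hom (Grph_m K P) (spine (Grph_m K P) n) G" "h \<in> hom (Grph_m K P) (spine (Grph_m K P) n) H"
  then have g: "g \<in> hom (Grph_m K P) (K n) G" and h: "h \<in> hom (Grph_m K P) (K n) H" by simp_all
  have "dom_graph (left_leg (P g h)) = G" "cod_graph (left_leg (P g h)) = apex (P g h)"
    "dom_graph (right_leg (P g h)) = H" "cod_graph (right_leg (P g h)) = apex (P g h)"
    "cod_graph g = G" "cod_graph h = H"
    using legs_P[OF g h] g h by (simp_all add: hom_Grph_m_iff)
  then show "fobj treewidth_functor (apex (proxy (Grph_m K P) g h)) =
        apex (proxy Nat_cat (farr treewidth_functor g) (farr treewidth_functor h)) \<and>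
      farr treewidth_functor (left_leg (proxy (Grph_m K P) g h)) =
        left_leg (proxy Nat_cat (farr treewidth_functor g) (farr treewidth_functor h)) \<and>
      farr treewidth_functor (right_leg (proxy (Grph_m K P) g h)) =
        right_leg (proxy Nat_cat (farr treewidth_functor g) (farr treewidth_functor h))"
    using treewidth_apex[OF g h] by (simp add: treewidth_functor_def Nat_cat_def)
qed (auto simp: treewidth_functor_def Nat_cat_def hom_Grph_m_iff Grph_def)

section \<open>Values of arbitrary S-functors\<close>

lemma S_functor_mono:
  assumes "S_functor (Grph_m K P) s" and "simple_graph G" and "simple_graph H"
    and "graph_embedding f G H"
  shows "fobj s G \<le> fobj s H"
proof -
  interpret spinal_functor "Grph_m K P" Nat_cat s by fact
  show ?thesis
    using farr_hom[OF hom_graph_embedding[OF assms(2-4)]] by (auto simp: hom_def Nat_cat_def)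
qed

text \<open>The spine fixes the value only on the chosen \<open>K n\<close>. Embeddings in both
  directions between \<open>G\<close> and \<open>K n\<close>, with antisymmetry, carry it to every
  complete graph of that size.\<close>

lemma S_functor_complete:
  assumes s: "S_functor (Grph_m K P) s" and G: "is_complete_graph n G"
  shows "fobj s G = n"
proof -
  interpret spinal_functor "Grph_m K P" Nat_cat s by fact
  have sG: "simple_graph G" "card (verts G) = n" "card (verts (K n)) = n"
    using G is_complete_K[of n] by (simp_all add: is_complete_graph_def)
  obtain f f' where "graph_embedding f G (K n)" "graph_embedding f' (K n) G"
    using complete_graph_embedding[OF sG(1,2) is_complete_K]
      complete_graph_embedding[OF simple_K sG(3) G] by blast
  then have "fobj s G = fobj s (K n)"
    using S_functor_mono[OF s] sG(1) simple_K by (metis antisym)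
  also have "\<dots> = n" using SF1[of n] by (simp add: Nat_cat_def)
  finally show ?thesis .
qed

lemma S_functor_apex:
  assumes s: "S_functor (Grph_m K P) s"
    and g: "g \<in> hom (Grph_m K P) (K n) G" and h: "h \<in> hom (Grph_m K P) (K n) H"
  shows "fobj s (apex (P g h)) = max (fobj s G) (fobj s H)"
proof -
  interpret spinal_functor "Grph_m K P" Nat_cat s by fact
  show ?thesis
    using SF2[of g n G h H] farr_hom[OF g] farr_hom[OF h] g h
    by (auto simp: hom_def Nat_cat_def)
qed

text \<open>The two sides are glued along the clique by a span out of \<open>K n\<close>. Its chosen
  apex need not be \<open>G\<close>, but it embeds into \<open>G\<close> by the map induced from the
  two inclusions, and \<open>G\<close> embeds into it by patching the legs together; hence both have
  the same value, and SF2 computes it.\<close>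

lemma S_functor_clique_separation:
  assumes s: "S_functor (Grph_m K P) s" and sG: "simple_graph G" and XY: "X \<union> Y = verts G"
    and S: "complete_subgraph G (X \<inter> Y)"
    and sep: "\<And>x y. x \<in> X - Y \<Longrightarrow> y \<in> Y - X \<Longrightarrow> {x, y} \<notin> edges G"
  shows "fobj s G = max (fobj s (induced_subgraph G X)) (fobj s (induced_subgraph G Y))"
proof -
  let ?A = "induced_subgraph G X" and ?B = "induced_subgraph G Y"
  have sA: "simple_graph ?A" and sB: "simple_graph ?B" using simple_induced_subgraph sG by auto
  have vA: "verts ?A = X" and vB: "verts ?B = Y" using XY by (auto simp: induced_subgraph_def)
  define n where "n = card (X \<inter> Y)"
  have fin: "finite (X \<inter> Y)" using sG XY by (auto simp: simple_graph_def dest: finite_subset[rotated])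
  have Kn: "finite (verts (K n))" "card (verts (K n)) = n"
    using is_complete_K[of n] by (auto simp: is_complete_graph_def simple_graph_def)
  obtain \<iota> where \<iota>: "bij_betw \<iota> (verts (K n)) (X \<inter> Y)"
    using finite_same_card_bij[OF Kn(1) fin] Kn(2) n_def by blast
  have edge\<iota>: "{\<iota> u, \<iota> v} \<in> edges G" "\<iota> u \<in> X \<inter> Y" "\<iota> v \<in> X \<inter> Y" if "{u, v} \<in> edges (K n)" for u v
  proof -
    have uv: "u \<in> verts (K n)" "v \<in> verts (K n)" "u \<noteq> v"
      using simple_graph_edge[OF simple_K that] .
    with \<iota> show "\<iota> u \<in> X \<inter> Y" "\<iota> v \<in> X \<inter> Y" by (auto simp: bij_betw_def)
    moreover have "\<iota> u \<noteq> \<iota> v" using uv \<iota> by (auto simp: bij_betw_def dest: inj_onD)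
    ultimately show "{\<iota> u, \<iota> v} \<in> edges G"
      using S unfolding complete_subgraph_def by blast
  qed
  have "graph_embedding \<iota> (K n) ?A" "graph_embedding \<iota> (K n) ?B"
    using \<iota> edge\<iota> unfolding graph_embedding_def vA vB
    by (auto simp: bij_betw_def induced_subgraph_def)
  then have g: "vertex_arrow (K n) \<iota> ?A \<in> hom (Grph_m K P) (K n) ?A" (is "?g \<in> _")
    and h: "vertex_arrow (K n) \<iota> ?B \<in> hom (Grph_m K P) (K n) ?B" (is "?h \<in> _")
    using hom_graph_embedding[OF simple_K] sA sB by blast+
  let ?c = "P ?g ?h"
  have l: "graph_embedding (vmap (left_leg ?c)) ?A (apex ?c)" and sc: "simple_graph (apex ?c)"
    and r: "graph_embedding (vmap (right_leg ?c)) ?B (apex ?c)"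
    using graph_embedding_hom legs_P[OF g h] by blast+
  have embA: "graph_embedding (\<lambda>x. x) ?A G" and embB: "graph_embedding (\<lambda>x. x) ?B G"
    by (auto simp: graph_embedding_def induced_subgraph_def)
  define a b where "a = vertex_arrow ?A (\<lambda>x. x) G" and "b = vertex_arrow ?B (\<lambda>x. x) G"
  have ab: "a \<in> hom (Grph_m K P) ?A G" "b \<in> hom (Grph_m K P) ?B G"
    using hom_graph_embedding sA sB sG embA embB unfolding a_def b_def by blast+
  have "cmp Grph a ?g = cmp Grph b ?h"
  proof (rule graph_arrow_eqI)
    show "graph_hom (cmp Grph a ?g)" "graph_hom (cmp Grph b ?h)"
      using monomorphism_cmp[OF g ab(1)] monomorphism_cmp[OF h ab(2)]
      by (simp_all add: hom_Grph_m_iff graph_hom_monomorphism)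
    fix v assume "v \<in> verts (dom_graph (cmp Grph a ?g))"
    then have "v \<in> verts (K n)" by simp
    moreover then have "\<iota> v \<in> X \<inter> Y" using \<iota> by (auto simp: bij_betw_def)
    ultimately show "vmap (cmp Grph a ?g) v = vmap (cmp Grph b ?h) v"
      by (simp add: compose_def a_def b_def vA vB)
  qed (simp_all add: a_def b_def)
  then obtain u where u: "u \<in> hom Grph (apex ?c) G"
    "cmp Grph u (left_leg ?c) = a" "cmp Grph u (right_leg ?c) = b"
    using pushout_P[OF g h] hom_Grph_m_Grph[OF ab(1)] hom_Grph_m_Grph[OF ab(2)]
    unfolding is_pushout_def by (simp only: Grph_simps vertex_arrow_simps) blast
  have dl: "dom_graph (left_leg ?c) = ?A" "dom_graph (right_leg ?c) = ?B"
    using legs_P[OF g h] by (simp_all add: hom_Grph_m_iff)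
  have "inj_on (vmap u) (verts (apex ?c))"
  proof (rule glued_cocone_inj_on[OF glued_P[OF g h], of "\<lambda>x. x" "\<lambda>x. x"])
    show "vmap u (vmap (left_leg ?c) x) = x" if "x \<in> verts (cod_graph ?g)" for x
      using that arg_cong[OF u(2), of "\<lambda>f. vmap f x"] dl by (simp add: a_def compose_def)
    show "vmap u (vmap (right_leg ?c) y) = y" if "y \<in> verts (cod_graph ?h)" for y
      using that arg_cong[OF u(3), of "\<lambda>f. vmap f y"] dl by (simp add: b_def compose_def)
    fix x y assume "x \<in> verts (cod_graph ?g)" "y \<in> verts (cod_graph ?h)" "x = y"
    then have "x \<in> \<iota> ` verts (K n)" using \<iota> vA vB by (simp add: bij_betw_def)
    with \<open>x = y\<close> show "\<exists>z \<in> verts (dom_graph ?g). x = vmap ?g z \<and> y = vmap ?h z" by auto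
  qed simp_all
  with u(1) have "graph_embedding (vmap u) (apex ?c) G"
    using monomorphism_graph_embedding(3)[of u] by (simp add: hom_Grph_iff monomorphism_Grph_iff)
  then have le: "fobj s (apex ?c) \<le> fobj s G" by (rule S_functor_mono[OF s sc sG])

  let ?l = "vmap (left_leg ?c)" and ?r = "vmap (right_leg ?c)"
  \<comment> \<open>On the overlap of \<open>X\<close> and \<open>Y\<close> the choice of leg is
    immaterial, because both legs agree on the image of \<open>K n\<close>; \<open>v_r\<close>
    records this.\<close>
  define v where "v p = (if p \<in> X then ?l p else ?r p)" for p
  have v_r: "v p = ?r p" if "p \<in> Y" for p
  proof (cases "p \<in> X")
    case True
    then obtain z where "z \<in> verts (K n)" "p = \<iota> z" using \<iota> \<open>p \<in> Y\<close> by (auto simp: bij_betw_def)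
    with True show ?thesis
      using vmap_cmp_eqD[OF legs_P(3)[OF g h], of z] by (simp add: v_def)
  qed (simp add: v_def)
  have "graph_embedding v G (apex ?c)"
    unfolding graph_embedding_def
  proof (intro conjI allI impI)
    show "v ` verts G \<subseteq> verts (apex ?c)"
      using l r unfolding graph_embedding_def vA vB XY[symmetric] by (auto simp: v_def)
    have cross: "x = y" if xy: "x \<in> X" "y \<in> Y" "?l x = ?r y" for x y
    proof -
      have "\<exists>z \<in> verts (K n). x = vmap ?g z \<and> y = vmap ?h z"
        using glued_P[OF g h] xy unfolding glued_cocone_def vertex_arrow_simps(1,2) vA vB by blast
      then show ?thesis by auto
    qed
    show "inj_on v (verts G)"
    proof (rule inj_onI)
      fix p q assume "p \<in> verts G" "q \<in> verts G" and eq: "v p = v q"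
      then consider "p \<in> X" "q \<in> X" | "p \<in> X" "q \<in> Y" | "p \<in> Y" "q \<in> X" | "p \<in> Y" "q \<in> Y"
        using XY by blast
      then show "p = q"
      proof cases
        case 1
        then show ?thesis using eq l unfolding graph_embedding_def vA by (simp add: v_def inj_on_def)
      next
        case 2
        then show ?thesis using eq cross v_r by (simp add: v_def)
      next
        case 3
        then show ?thesis using eq cross[of q p] v_r by (simp add: v_def)
      next
        case 4
        then show ?thesis using eq r unfolding graph_embedding_def vB by (simp add: v_r inj_on_def)
      qed
    qed
    fix p q assume e: "{p, q} \<in> edges G"
    then have "p \<in> verts G" "q \<in> verts G" using simple_graph_edge[OF sG] by blast+
    \<comment> \<open>The separation hypothesis is used here: no edge of \<open>G\<close> crosses,
      so each edge is seen by one of the legs.\<close>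
    then have "p \<in> X \<and> q \<in> X \<or> p \<in> Y \<and> q \<in> Y"
      using sep[of p q] sep[of q p] e XY by (auto simp: insert_commute)
    then show "{v p, v q} \<in> edges (apex ?c)"
    proof
      assume "p \<in> X \<and> q \<in> X"
      with e l show ?thesis by (simp add: graph_embedding_def v_def induced_subgraph_def)
    next
      assume "p \<in> Y \<and> q \<in> Y"
      with e r show ?thesis by (simp add: graph_embedding_def v_r induced_subgraph_def)
    qed
  qed
  then have "fobj s G \<le> fobj s (apex ?c)" by (rule S_functor_mono[OF s sG sc])
  with le have "fobj s G = fobj s (apex ?c)" by (rule antisym[rotated])
  then show ?thesis by (simp only: S_functor_apex[OF s g h])
qed

lemma S_functors_agree_on_chordal:
  assumes s: "S_functor (Grph_m K P) s" and t: "S_functor (Grph_m K P) t"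
  shows "simple_graph G \<Longrightarrow> chordal G \<Longrightarrow> fobj s G = fobj t G"
proof (induction "card (verts G)" arbitrary: G rule: less_induct)
  case less
  show ?case
  proof (cases "complete_subgraph G (verts G)")
    case True
    then have "is_complete_graph (card (verts G)) G"
      using less.prems by (simp add: is_complete_graph_def)
    then show ?thesis using S_functor_complete[OF s] S_functor_complete[OF t] by simp
  next
    case False
    obtain X Y where XY: "X \<union> Y = verts G" "X \<subset> verts G" "Y \<subset> verts G"
      and S: "complete_subgraph G (X \<inter> Y)"
      and sep: "\<And>x y. x \<in> X - Y \<Longrightarrow> y \<in> Y - X \<Longrightarrow> {x, y} \<notin> edges G"
      using chordal_clique_separation[OF less.prems False] by blast
    \<comment> \<open>Both sides of the separation are proper, so the induction hypothesis reaches
      them, and induced subgraphs stay chordal.\<close>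
    have "fobj s (induced_subgraph G Z) = fobj t (induced_subgraph G Z)" if "Z \<subset> verts G" for Z
    proof (rule less.hyps)
      have "verts (induced_subgraph G Z) = Z" using that by (auto simp: induced_subgraph_def)
      then show "card (verts (induced_subgraph G Z)) < card (verts G)"
        using that less.prems(1) by (simp add: simple_graph_def psubset_card_mono)
    qed (use less.prems simple_induced_subgraph chordal_induced_subgraph in auto)
    with XY show ?thesis
      using S_functor_clique_separation[OF s less.prems(1) XY(1) S sep]
        S_functor_clique_separation[OF t less.prems(1) XY(1) S sep] by simp
  qed
qed

lemma triangulation_eq_treewidth:
  assumes s: "S_functor (Grph_m K P) s" and sG: "simple_graph G"
  shows "triangulation (Grph_m K P) s G = treewidth G"
proof -
  let ?k = "\<lambda>k. \<exists>H \<in> pseudo_chordal (Grph_m K P). hom (Grph_m K P) G H \<noteq> {} \<and> k = fobj s H"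
  obtain G' where G': "chordal_completion G G'" "treewidth G = clique_number G'"
    using sG by (rule treewidth_attained)
  have sG': "simple_graph G'" "chordal G'" using G' by (simp_all add: chordal_completion_def)
  have "G' \<in> pseudo_chordal (Grph_m K P)"
    using sG' S_functors_agree_on_chordal[OF _ _ sG'] unfolding pseudo_chordal_def Grph_m_simps by blast
  moreover have "hom (Grph_m K P) G G' \<noteq> {}"
    using hom_graph_embedding[OF sG sG'(1) chordal_completion_embedding[OF G'(1)]] by blast
  moreover have "fobj s G' = treewidth G"
    using S_functors_agree_on_chordal[OF s treewidth_S_functor sG'] treewidth_chordal[OF sG'] G'(2)
    by (simp add: treewidth_functor_def)
  ultimately have "?k (treewidth G)" by (intro bexI[of _ G'] conjI) simp_all
  moreover have "treewidth G \<le> k" if *: "?k k" for k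
  proof -
    obtain H f where H: "H \<in> pseudo_chordal (Grph_m K P)" "f \<in> hom (Grph_m K P) G H" "k = fobj s H"
      using * by blast
    \<comment> \<open>Pseudo-chordality is instantiated with treewidth itself as the second
      S-functor.\<close>
    have "fobj s H = fobj treewidth_functor H"
      using H(1) s treewidth_S_functor unfolding pseudo_chordal_def by blast
    then have "fobj s H = treewidth H" by (simp add: treewidth_functor_def)
    then show ?thesis using treewidth_mono[OF graph_embedding_hom[OF H(2)]] H(3) by simp
  qed
  ultimately show ?thesis unfolding triangulation_def by (rule Least_equality)
qed

end

theorem theorem2p3:
  fixes K :: "nat \<Rightarrow> 'v::infinite graph"
    and P :: "'v graph_arrow \<Rightarrow> 'v graph_arrow \<Rightarrow> ('v graph, 'v graph_arrow) cocone"
  assumes "complete_graph_choice K"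
    and "pushout_choice K P"
  shows "measurable (Grph_m K P) \<and>
    (\<forall>s. S_functor (Grph_m K P) s \<longrightarrow>
      (\<forall>G. simple_graph G \<longrightarrow> triangulation (Grph_m K P) s G = treewidth G))"
proof -
  interpret graph_choices K P using assms by unfold_locales
  show ?thesis
    using spined_category_Grph_m treewidth_S_functor triangulation_eq_treewidth
    unfolding measurable_def by blast
qed

end
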